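(* Let $f_1,\dots,f_n$, $W$, the iterates $x_{(i)}(k)$ and the notation be as in the context. If $f=\sum_{i=1}^n f_i$ is either strongly convex (modulus $\mu_f>0$) or restricted strongly convex (modulus $\nu_f>0$), with $c_1,c_2$ the corresponding constants defined in the context, and if the stepsize $\alpha>0$ satisfies $$\alpha<\min\Big\{\frac{1+\lambda_n(W)}{L_h},\,c_1\Big\}$$ and $\beta<1$, then $$\|x_{(i)}(k)-x^*(k)\|\le c_3^k\|x^*(0)\|+\frac{c_4}{\sqrt{1-c_3^2}}+\frac{\alpha D}{1-\beta},$$ where $x^*(k)=\mathrm{Proj}_{\mathcal{X}^*}(\bar x(k))\in\mathcal{X}^*$ (in particular $x^*(0)=\mathrm{Proj}_{\mathcal{X}^*}(\bar x(0))$), $\bar x(k)=\frac1n\sum_{i=1}^nx_{(i)}(k)$, and $$c_3^2=1-\alpha c_2+\alpha\delta-\alpha^2\delta c_2,\qquad c_4^2=\alpha^3(\alpha+\delta^{-1})\frac{L_h^2D^2}{(1-\beta)^2},\qquad D=\sqrt{2L_h\sum_{i=1}^n\big(f_i(0)-f_i^o\big)},$$ with $\delta$ any positive constant.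
   Context: Setting: $n$ agents in a network seek to minimize $f(x)=\sum_{i=1}^n f_i(x)$ over $x\in\mathbb{R}^p$; the set $\mathcal{X}^*$ of minimizers of $f$ is assumed non-empty. Assumptions: (a) For $i=1,\dots,n$, $f_i$ is proper closed convex, lower bounded, and Lipschitz differentiable, i.e. $\nabla f_i$ is Lipschitz continuous with constant $L_{f_i}>0$. (b) The network has a synchronized clock (all agents apply the iteration at the same time intervals), the network is connected, and the mixing matrix $W=[w_{ij}]\in\mathbb{R}^{n\times n}$ is symmetric and doubly stochastic, with eigenvalues $1=\lambda_1(W)\ge\dots\ge\lambda_n(W)\ge-1$ and $\beta:=\max\{|\lambda_2(W)|,|\lambda_n(W)|\}<1$. Iteration: $x_{(i)}(0)=0$ and $x_{(i)}(k+1)=\sum_{j=1}^n w_{ij}x_{(j)}(k)-\alpha\nabla f_i(x_{(i)}(k))$, $i=1,\dots,n$. $f$ is strongly convex with modulus $\mu_f$ if $\langle\nabla f(x_a)-\nabla f(x_b),x_a-x_b\rangle\ge\mu_f\|x_a-x_b\|^2$ for all $x_a,x_b$. $f$ is restricted strongly convex with modulus $\nu_f$ if $\langle\nabla f(x)-\nabla f(x^* ),x-x^*\rangle\ge\nu_f\|x-x^*\|^2$ for all $x$, where $x^*=\mathrm{Proj}_{\mathcal{X}^*}(x)$ is the Euclidean projection onto $\mathcal{X}^*$ (and $\nabla f(x^* )=0$). Constants: $L_h=\max_iL_{f_i}$, $L_{\bar f}=\frac1n\sum_{i=1}^nL_{f_i}$, $\mu_{\bar f}=\mu_f/n$, $\nu_{\bar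 f}=\nu_f/n$; $f_i^o=f_i(x_{(i)}^o)$ with $x_{(i)}^o=\arg\min_x f_i(x)$. In the strongly convex case $c_1=\frac1{\mu_{\bar f}+L_{\bar f}}$ and $c_2=\frac{\mu_{\bar f}L_{\bar f}}{\mu_{\bar f}+L_{\bar f}}$. In the restricted strongly convex case $c_1=\frac{\theta}{L_{\bar f}}$ and $c_2=(1-\theta)\nu_{\bar f}$ for any $\theta\in[0,1]$. Norms are Euclidean.
   Formalization: The condition c_3 < 1 (with c_3 ≥ 0 the nonnegative root) is added: for large positive δ, or for θ = 1, one has c_3^2 > 1 and the term c_4/√(1−c_3^2) in the bound is undefined, so δ cannot be any positive constant. *)

theory Defs
  imports "HOL-Analysis.Analysis" "Jordan_Normal_Form.Char_Poly"
begin

text \<open>Only meaningful where \<open>f\<close> is differentiable; see \<open>gderiv_grad\<close> below.\<close>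

definition grad :: "('a::euclidean_space \<Rightarrow> real) \<Rightarrow> 'a \<Rightarrow> 'a" where
  "grad f x = (THE D. GDERIV f x :> D)"

lemma grad_eqI: "GDERIV f x :> D \<Longrightarrow> grad f x = D"
  unfolding grad_def
proof (rule the_equality)
  fix D' assume "GDERIV f x :> D" "GDERIV f x :> D'"
  then have "(\<lambda>h. inner h D) = (\<lambda>h. inner h D')"
    unfolding gderiv_def by (rule has_derivative_unique)
  then have "inner (D' - D) D = inner (D' - D) D'"
    by (rule fun_cong)
  then have "inner (D' - D) (D' - D) = 0"
    by (simp only: inner_diff_right)
  then show "D' = D"
    by simp
qed

lemma gderiv_grad:
  fixes f :: "'a::euclidean_space \<Rightarrow> real"
  assumes "f differentiable (at x)"
  shows "GDERIV f x :> grad f x"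
proof -
  obtain f' where f': "(f has_derivative f') (at x)"
    using assms by (auto simp: differentiable_def)
  then have "f' h = inner h (adjoint f' 1)" for h
    using adjoint_works[OF has_derivative_linear[OF f'], of h 1] by simp
  then have "f' = (\<lambda>h. inner h (adjoint f' 1))"
    by (rule ext)
  with f' have "GDERIV f x :> adjoint f' 1"
    unfolding gderiv_def by (rule has_derivative_eq_rhs)
  with grad_eqI[OF this] show ?thesis
    by (simp only:)
qed

definition minimizers :: "('a \<Rightarrow> real) \<Rightarrow> 'a set" where
  "minimizers F = {x. is_arg_min F (\<lambda>_. True) x}"

text \<open>
  The optimal value of a lower bounded function. A lower bounded convex function need not attain
  its infimum; when it does, this is its value at any minimizer.
\<close>

definition opt_value :: "('a \<Rightarrow> real) \<Rightarrow> real" where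
  "opt_value f = (INF x. f x)"

lemma opt_value_eq:
  assumes "is_arg_min f (\<lambda>_. True) x"
  shows "opt_value f = f x"
  unfolding opt_value_def
  by (rule cInf_eq_minimum) (use assms in \<open>auto simp: is_arg_min_linorder\<close>)

definition strongly_convex :: "('a::euclidean_space \<Rightarrow> real) \<Rightarrow> real \<Rightarrow> bool" where
  "strongly_convex F \<mu> \<longleftrightarrow>
     (\<forall>xa xb. (grad F xa - grad F xb) \<bullet> (xa - xb) \<ge> \<mu> * (norm (xa - xb))\<^sup>2)"

definition restricted_strongly_convex :: "('a::euclidean_space \<Rightarrow> real) \<Rightarrow> real \<Rightarrow> bool" where
  "restricted_strongly_convex F \<nu> \<longleftrightarrow>
     (\<forall>x. let xs = closest_point (minimizers F) x
          in (grad F x - grad F xs) \<bullet> (x - xs) \<ge> \<nu> * (norm (x - xs))\<^sup>2)"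

text \<open>Agents are \<open>0, \<dots>, n - 1\<close>.\<close>

definition connected_network :: "nat \<Rightarrow> (nat \<times> nat) set \<Rightarrow> bool" where
  "connected_network n E \<longleftrightarrow>
     E \<subseteq> {..<n} \<times> {..<n} \<and> sym E \<and> (\<forall>i<n. \<forall>j<n. (i, j) \<in> E\<^sup>*)"

definition doubly_stochastic :: "nat \<Rightarrow> real mat \<Rightarrow> bool" where
  "doubly_stochastic n W \<longleftrightarrow>
     (\<forall>i<n. \<forall>j<n. 0 \<le> W $$ (i, j)) \<and>
     (\<forall>i<n. (\<Sum>j<n. W $$ (i, j)) = 1) \<and>
     (\<forall>j<n. (\<Sum>i<n. W $$ (i, j)) = 1)"

definition mixing_matrix :: "nat \<Rightarrow> (nat \<times> nat) set \<Rightarrow> real mat \<Rightarrow> bool" where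
  "mixing_matrix n E W \<longleftrightarrow>
     W \<in> carrier_mat n n \<and> transpose_mat W = W \<and> doubly_stochastic n W \<and>
     (\<forall>i<n. \<forall>j<n. i \<noteq> j \<longrightarrow> (i, j) \<notin> E \<longrightarrow> W $$ (i, j) = 0)"

text \<open>
  Real eigenvalues with algebraic multiplicity, in nonincreasing order; a symmetric \<open>n \<times> n\<close>
  matrix has exactly \<open>n\<close> of them. The index \<open>j\<close> of \<open>eigval\<close> starts at 1.
\<close>

definition eigvals_desc :: "real mat \<Rightarrow> real list" where
  "eigvals_desc A = rev (sorted_list_of_multiset (proots (char_poly A)))"

definition eigval :: "real mat \<Rightarrow> nat \<Rightarrow> real" where
  "eigval A j = eigvals_desc A ! (j - 1)"

primrec dgd ::
  "nat \<Rightarrow> real mat \<Rightarrow> real \<Rightarrow> (nat \<Rightarrow> 'a::euclidean_space \<Rightarrow> real) \<Rightarrow> nat \<Rightarrow> nat \<Rightarrow> 'a" where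
  "dgd n W \<alpha> f 0 = (\<lambda>i. 0)"
| "dgd n W \<alpha> f (Suc k) =
     (\<lambda>i. (\<Sum>j<n. W $$ (i, j) *\<^sub>R dgd n W \<alpha> f k j) - \<alpha> *\<^sub>R grad (f i) (dgd n W \<alpha> f k i))"

definition dgd_mean ::
  "nat \<Rightarrow> real mat \<Rightarrow> real \<Rightarrow> (nat \<Rightarrow> 'a::euclidean_space \<Rightarrow> real) \<Rightarrow> nat \<Rightarrow> 'a" where
  "dgd_mean n W \<alpha> f k = (1 / real n) *\<^sub>R (\<Sum>i<n. dgd n W \<alpha> f k i)"

end

theory Submission
  imports Defs "Jordan_Normal_Form.Schur_Decomposition"
begin

text \<open>
  One step of the iteration is a unit gradient step on the energy
  \<open>\<xi>(x) = (\<parallel>x\<parallel>\<^sup>2 - \<langle>x, W x\<rangle>) / 2 + \<alpha> \<Sum>\<^sub>i f\<^sub>i(x\<^sub>i)\<close>, whose gradient is Lipschitz with constant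
  \<open>1 - \<lambda>\<^sub>n(W) + \<alpha> L\<^sub>h \<le> 2\<close>. Hence \<open>\<xi>\<close> decreases along the iterates, which bounds the function values and
  therefore all gradients: \<open>\<Sum>\<^sub>i \<parallel>\<nabla>f\<^sub>i(x\<^sub>i(k))\<parallel>\<^sup>2 \<le> D\<^sup>2\<close>. As \<open>W\<close> contracts vectors of mean zero by \<open>\<beta>\<close>,
  the distance of the iterates to their mean stays below \<open>\<alpha> D / (1 - \<beta>)\<close>. The mean itself performs a
  gradient step for \<open>f / n\<close> with an error of size \<open>L\<^sub>h \<alpha> D / (1 - \<beta>)\<close>; the exact step contracts the distance
  to the minimizers, and Young's inequality with weight \<open>\<alpha> \<delta>\<close> absorbs the error.
\<close>

unbundle no vec_syntax and no inner_syntax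

subsection \<open>Spectral decomposition of symmetric matrices\<close>

text \<open>The fundamental theorem of algebra supplies a complex root of the characteristic
  polynomial, and symmetry forces that root to be real.\<close>

lemma symmetric_real_mat_eigenvalue:
  fixes A :: "real mat"
  assumes A: "A \<in> carrier_mat n n" and sym: "transpose_mat A = A" and n: "n > 0"
  shows "\<exists>e. eigenvalue A e"
proof -
  define B where "B = map_mat complex_of_real A"
  have B: "B \<in> carrier_mat n n" using A by (simp add: B_def)
  have "degree (char_poly B) = n" using degree_monic_char_poly[OF B] by simp
  then have "\<not> constant (poly (char_poly B))" using n by (simp add: constant_degree)
  then obtain z where z: "poly (char_poly B) z = 0" using fundamental_theorem_of_algebra by blast
  then have "eigenvalue B z" using eigenvalue_root_char_poly[OF B] by simp
  then obtain v where v: "v \<in> carrier_vec n" "v \<noteq> 0\<^sub>v n" "B *\<^sub>v v = z \<cdot>\<^sub>v v"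
    using B by (auto simp: eigenvalue_def eigenvector_def)
  have Bv: "(\<Sum>j<n. of_real (A $$ (i,j)) * v $ j) = z * v $ i" if "i < n" for i
  proof -
    have "(B *\<^sub>v v) $ i = (z \<cdot>\<^sub>v v) $ i" using v by simp
    then show ?thesis using that v(1) A
      by (simp add: B_def scalar_prod_def lessThan_atLeast0)
  qed
  have symA: "A $$ (i,j) = A $$ (j,i)" if "i < n" "j < n" for i j
    using that A by (metis sym carrier_matD index_transpose_mat(1))
  define s where "s = (\<Sum>i<n. v $ i * cnj (v $ i))"
  have s_real: "s = of_real (\<Sum>i<n. (cmod (v $ i))\<^sup>2)"
    by (simp add: s_def complex_norm_square[symmetric])
  have "s \<noteq> 0"
  proof
    assume "s = 0"
    then have "(\<Sum>i<n. (cmod (v $ i))\<^sup>2) = 0" using s_real by (metis of_real_eq_0_iff)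
    then have "\<forall>i<n. v $ i = 0" by (simp add: sum_nonneg_eq_0_iff)
    then show False using v(1,2) by (auto intro: eq_vecI)
  qed
  \<comment> \<open>Two evaluations of the Hermitian form of \<open>B\<close> at \<open>v\<close>:
    applying the matrix to \<open>v\<close> gives \<open>z * s\<close>, while moving it to the
    conjugated factor by symmetry gives \<open>cnj z * s\<close>.\<close>
  have "z * s = (\<Sum>i<n. (\<Sum>j<n. of_real (A $$ (i,j)) * v $ j) * cnj (v $ i))"
    by (simp add: s_def sum_distrib_left Bv mult.assoc)
  also have "\<dots> = (\<Sum>i<n. \<Sum>j<n. of_real (A $$ (i,j)) * v $ j * cnj (v $ i))"
    by (simp add: sum_distrib_right)
  also have "\<dots> = (\<Sum>j<n. \<Sum>i<n. of_real (A $$ (i,j)) * v $ j * cnj (v $ i))"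
    by (rule sum.swap)
  also have "\<dots> = (\<Sum>j<n. v $ j * cnj (\<Sum>i<n. of_real (A $$ (j,i)) * v $ i))"
    by (auto simp: sum_distrib_left symA intro!: sum.cong)
  also have "\<dots> = cnj z * s"
    by (simp add: Bv) (simp add: s_def sum_distrib_left mult_ac)
  finally have "z = cnj z" using \<open>s \<noteq> 0\<close> by simp
  then have "z = of_real (Re z)" by (metis Reals_cnj_iff of_real_Re)
  moreover have "char_poly B = map_poly of_real (char_poly A)"
    unfolding B_def by (rule of_real_hom.char_poly_hom[OF A])
  ultimately have "complex_of_real (poly (char_poly A) (Re z)) = 0"
    using z by (metis of_real_hom.poly_map_poly)
  then show ?thesis using eigenvalue_root_char_poly[OF A] by auto
qed

text \<open>Complete \<open>v\<close> to a basis that starts with \<open>v\<close>. Gram-Schmidt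
  keeps the first vector, so normalizing the columns only rescales \<open>v\<close>.\<close>

lemma orthogonal_mat_first_col:
  fixes v :: "real Matrix.vec"
  assumes v: "v \<in> carrier_vec n" "v \<noteq> 0\<^sub>v n"
  shows "\<exists>U c. U \<in> carrier_mat n n \<and> transpose_mat U * U = 1\<^sub>m n \<and> col U 0 = c \<cdot>\<^sub>v v"
proof -
  interpret cof_vec_space n "TYPE(real)" .
  define b where "b = basis_completion v"
  define ws where "ws = gram_schmidt n b"
  note basis = basis_completion[OF v, folded b_def]
  have "n \<noteq> 0" using v by (auto intro: eq_vecI)
  then obtain vs where b: "b = v # vs" using basis by (cases b) auto
  have ws: "set ws \<subseteq> carrier_vec n" "corthogonal ws" "length ws = n"
    using gram_schmidt_result[OF basis(2) basis(4) basis(5) refl, folded ws_def] basis by auto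
  have hd: "hd ws = v" using gram_schmidt_hd[OF v(1), of vs, folded b] unfolding ws_def .
  have ws_carrier: "ws ! j \<in> carrier_vec n" if "j < n" for j using ws that by auto
  have orth: "scalar_prod (ws ! i) (ws ! j) = 0 \<longleftrightarrow> i \<noteq> j" if "i < n" "j < n" for i j
    using corthogonalD[OF ws(2), of i j] ws(3) that by simp
  define q where "q j = scalar_prod (ws ! j) (ws ! j)" for j
  have q: "q j > 0" if "j < n" for j
  proof -
    have "q j \<ge> 0" by (simp add: q_def scalar_prod_def sum_nonneg)
    then show ?thesis using orth[OF that that] by (simp add: q_def)
  qed
  define U where "U = mat_of_cols n (map (\<lambda>w. (1 / sqrt (scalar_prod w w)) \<cdot>\<^sub>v w) ws)"
  have U: "U \<in> carrier_mat n n" using ws mat_of_cols_carrier(1)[of n "map (\<lambda>w. (1 / sqrt (scalar_prod w w)) \<cdot>\<^sub>v w) ws"]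
    by (simp add: U_def)
  have colU: "col U j = (1 / sqrt (q j)) \<cdot>\<^sub>v (ws ! j)" if "j < n" for j
    using that ws ws_carrier[OF that] by (simp add: U_def q_def col_mat_of_cols)
  have "transpose_mat U * U = 1\<^sub>m n"
  proof (rule eq_matI)
    fix i j assume "i < dim_row (1\<^sub>m n :: real mat)" "j < dim_col (1\<^sub>m n :: real mat)"
    then have ij: "i < n" "j < n" by auto
    have "(transpose_mat U * U) $$ (i,j) = scalar_prod (col U i) (col U j)" using U ij by simp
    also have "\<dots> = (1 / sqrt (q i)) * ((1 / sqrt (q j)) * scalar_prod (ws ! i) (ws ! j))"
      using ij ws_carrier[OF ij(1)] ws_carrier[OF ij(2)] by (simp add: colU)
    also have "\<dots> = (1\<^sub>m n) $$ (i,j)"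
    proof (cases "i = j")
      case True
      then show ?thesis using q[OF ij(1)] ij by (simp add: q_def[symmetric] real_sqrt_mult_self)
    next
      case False
      then show ?thesis using orth[OF ij] ij by simp
    qed
    finally show "(transpose_mat U * U) $$ (i,j) = (1\<^sub>m n) $$ (i,j)" .
  qed (use U in auto)
  moreover have "col U 0 = (1 / sqrt (q 0)) \<cdot>\<^sub>v v"
    using colU[of 0] hd \<open>n \<noteq> 0\<close> ws(3) by (cases ws) auto
  ultimately show ?thesis using U by blast
qed

text \<open>Deflation: in an orthonormal basis that starts with an eigenvector the matrix splits
  into a 1 by 1 block and a smaller symmetric block, to which the induction hypothesis
  applies.\<close>

lemma symmetric_mat_orthogonal_diag:
  fixes A :: "real mat"
  assumes "A \<in> carrier_mat n n" "transpose_mat A = A"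
  shows "\<exists>U d. U \<in> carrier_mat n n \<and> transpose_mat U * U = 1\<^sub>m n \<and>
    transpose_mat U * A * U = mat_diag n d"
  using assms
proof (induction n arbitrary: A)
  case 0
  then have "1\<^sub>m 0 \<in> carrier_mat 0 0 \<and> transpose_mat (1\<^sub>m 0) * (1\<^sub>m 0) = (1\<^sub>m 0 :: real mat) \<and>
    transpose_mat (1\<^sub>m 0) * A * 1\<^sub>m 0 = mat_diag 0 (\<lambda>_. 0)"
    by (auto intro!: eq_matI simp: mat_diag_def)
  then show ?case by blast
next
  case (Suc m)
  let ?n = "Suc m"
  obtain e v where "eigenvector A v e"
    using symmetric_real_mat_eigenvalue[OF Suc.prems] by (auto simp: eigenvalue_def)
  then have v: "v \<in> carrier_vec ?n" "v \<noteq> 0\<^sub>v ?n" "A *\<^sub>v v = e \<cdot>\<^sub>v v"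
    using Suc.prems by (auto simp: eigenvector_def)
  obtain U c where U: "U \<in> carrier_mat ?n ?n" "transpose_mat U * U = 1\<^sub>m ?n" "col U 0 = c \<cdot>\<^sub>v v"
    using orthogonal_mat_first_col[OF v(1,2)] by blast
  have [simp]: "transpose_mat U \<in> carrier_mat ?n ?n" using U by simp
  define A' where "A' = transpose_mat U * A * U"
  have A': "A' \<in> carrier_mat ?n ?n" using U(1) Suc.prems by (auto simp: A'_def intro!: mult_carrier_mat)
  have "transpose_mat A' = transpose_mat U * (A * U)"
    using U(1) Suc.prems by (simp add: A'_def transpose_mult[of _ ?n ?n _ ?n])
  also have "\<dots> = A'" using U(1) Suc.prems by (simp add: A'_def)
  finally have symA': "transpose_mat A' = A'" .
  \<comment> \<open>Column 0 of \<open>U\<close> is an eigenvector for \<open>e\<close>, and the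
    columns of \<open>U\<close> are orthonormal. By symmetry the first row of \<open>A'\<close> has
    the same entries.\<close>
  have A'0: "A' $$ (i, 0) = (if i = 0 then e else 0)" if "i < ?n" for i
  proof -
    have "A' $$ (i, 0) = (transpose_mat U * (A * U)) $$ (i, 0)"
      using U(1) Suc.prems by (simp add: A'_def)
    also have "\<dots> = scalar_prod (col U i) (A *\<^sub>v col U 0)"
      using that U(1) Suc.prems by (simp add: mult_mat_vec_def)
    also have "A *\<^sub>v col U 0 = e \<cdot>\<^sub>v col U 0"
      using v Suc.prems U by (simp add: mult_mat_vec smult_smult_assoc mult.commute)
    also have "scalar_prod (col U i) (e \<cdot>\<^sub>v col U 0) = e * scalar_prod (col U i) (col U 0)"
      using U(1) that by (intro scalar_prod_smult_right) auto
    also have "scalar_prod (col U i) (col U 0) = (transpose_mat U * U) $$ (i, 0)"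
      using U(1) that by simp
    finally show ?thesis using U(2) that by simp
  qed
  define A3 where "A3 = Matrix.mat m m (\<lambda>(i,j). A' $$ (Suc i, Suc j))"
  have A'sym: "A' $$ (i,j) = A' $$ (j,i)" if "i < ?n" "j < ?n" for i j
    using that A' by (metis symA' carrier_matD index_transpose_mat(1))
  have A3: "A3 \<in> carrier_mat m m" "transpose_mat A3 = A3"
    by (auto simp: A3_def A'sym intro!: eq_matI)
  obtain V d where V: "V \<in> carrier_mat m m" "transpose_mat V * V = 1\<^sub>m m"
    "transpose_mat V * A3 * V = mat_diag m d"
    using Suc.IH[OF A3] by blast
  have A'block: "A' = four_block_mat (Matrix.mat 1 1 (\<lambda>_. e)) (0\<^sub>m 1 m) (0\<^sub>m m 1) A3"
  proof (rule eq_matI)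
    fix i j
    assume "i < dim_row (four_block_mat (Matrix.mat 1 1 (\<lambda>_. e)) (0\<^sub>m 1 m) (0\<^sub>m m 1) A3)"
      and "j < dim_col (four_block_mat (Matrix.mat 1 1 (\<lambda>_. e)) (0\<^sub>m 1 m) (0\<^sub>m m 1) A3)"
    then have "i < ?n" "j < ?n" using A3 by auto
    then show "A' $$ (i,j) = four_block_mat (Matrix.mat 1 1 (\<lambda>_. e)) (0\<^sub>m 1 m) (0\<^sub>m m 1) A3 $$ (i,j)"
      using A3 A'0[of i] A'0[of j] A'sym[of 0 j] by (cases i; cases j) (auto simp: A3_def)
  qed (use A' A3 in auto)
  \<comment> \<open>The diagonalizing matrix of the smaller block, extended by the identity on the
    eigenvector already split off.\<close>
  define V' where "V' = four_block_mat (1\<^sub>m 1) (0\<^sub>m 1 m) (0\<^sub>m m 1) V"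
  have V': "V' \<in> carrier_mat ?n ?n" using V by (auto simp: V'_def)
  have V't: "transpose_mat V' = four_block_mat (1\<^sub>m 1) (0\<^sub>m 1 m) (0\<^sub>m m 1) (transpose_mat V)"
    using V unfolding V'_def by (subst transpose_four_block_mat[of _ 1 1 _ m _ m]) auto
  have V't_carrier: "transpose_mat V' \<in> carrier_mat ?n ?n" using V' by simp
  have tV: "transpose_mat V \<in> carrier_mat m m" using V by simp
  have V'orth: "transpose_mat V' * V' = 1\<^sub>m ?n"
    unfolding V't unfolding V'_def using V tV
    by (subst mult_four_block_mat[of _ 1 1 _ m _ m _ _ 1 _ m]) (auto intro!: eq_matI)
  have V'diag: "transpose_mat V' * A' * V' = mat_diag ?n (case_nat e d)"
  proof -
    have "transpose_mat V' * A' * V' =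
      four_block_mat (Matrix.mat 1 1 (\<lambda>_. e)) (0\<^sub>m 1 m) (0\<^sub>m m 1) (transpose_mat V * A3 * V)"
      unfolding V't A'block unfolding V'_def using V(1) tV A3
      apply (subst mult_four_block_mat[of _ 1 1 _ m _ m _ _ 1 _ m]; (simp; fail)?)
      apply (subst mult_four_block_mat[of _ 1 1 _ m _ m _ _ 1 _ m]; (simp; fail)?)
      done
    also have "\<dots> = mat_diag ?n (case_nat e d)"
      unfolding V(3) by (rule eq_matI) (auto simp: mat_diag_def split: nat.splits)
    finally show ?thesis .
  qed
  define Q where "Q = U * V'"
  have Qt: "transpose_mat Q = transpose_mat V' * transpose_mat U"
    unfolding Q_def by (rule transpose_mult[OF U(1) V'])
  have "transpose_mat Q * Q = transpose_mat V' * ((transpose_mat U * U) * V')"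
    unfolding Qt unfolding Q_def using U(1) V' V't_carrier
    by (simp add: assoc_mult_mat[of _ ?n ?n _ ?n _ ?n])
  then have "transpose_mat Q * Q = 1\<^sub>m ?n" using U(2) V' V'orth by simp
  moreover have "transpose_mat Q * A * Q = transpose_mat V' * A' * V'"
    unfolding Qt unfolding Q_def A'_def using U(1) V' V't_carrier Suc.prems
    by (simp add: assoc_mult_mat[of _ ?n ?n _ ?n _ ?n] mult_carrier_mat[of _ ?n ?n _ ?n])
  moreover have "Q \<in> carrier_mat ?n ?n" using U(1) V' by (simp add: Q_def)
  ultimately show ?case using V'diag by metis
qed

text \<open>\<open>u k\<close> is the \<open>k\<close>-th eigenvector as a family of coordinates.
  Orthonormality of rows and of columns serve different lemmas below; the last clause identifies
  \<open>d\<close> with the eigenvalues counted with multiplicity, which ties it to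
  \<open>eigval\<close>.\<close>

definition spectral_decomposition ::
  "real mat \<Rightarrow> nat \<Rightarrow> (nat \<Rightarrow> nat \<Rightarrow> real) \<Rightarrow> (nat \<Rightarrow> real) \<Rightarrow> bool" where
  "spectral_decomposition A n u d \<longleftrightarrow>
    (\<forall>k<n. \<forall>l<n. (\<Sum>i<n. u k i * u l i) = of_bool (k = l)) \<and>
    (\<forall>i<n. \<forall>j<n. (\<Sum>k<n. u k i * u k j) = of_bool (i = j)) \<and>
    (\<forall>i<n. \<forall>j<n. A $$ (i,j) = (\<Sum>k<n. d k * (u k i * u k j))) \<and>
    proots (char_poly A) = image_mset d (mset_set {..<n})"

lemma spectral_decompositionD:
  assumes "spectral_decomposition A n u d"
  shows "k < n \<Longrightarrow> l < n \<Longrightarrow> (\<Sum>i<n. u k i * u l i) = of_bool (k = l)"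
    and "i < n \<Longrightarrow> j < n \<Longrightarrow> (\<Sum>k<n. u k i * u k j) = of_bool (i = j)"
    and "i < n \<Longrightarrow> j < n \<Longrightarrow> A $$ (i,j) = (\<Sum>k<n. d k * (u k i * u k j))"
    and "proots (char_poly A) = image_mset d (mset_set {..<n})"
  using assms unfolding spectral_decomposition_def by blast+

lemma symmetric_mat_spectral:
  fixes A :: "real mat"
  assumes A: "A \<in> carrier_mat n n" "transpose_mat A = A"
  shows "\<exists>u d. spectral_decomposition A n u d"
proof -
  obtain U d where U: "U \<in> carrier_mat n n" "transpose_mat U * U = 1\<^sub>m n"
    "transpose_mat U * A * U = mat_diag n d"
    using symmetric_mat_orthogonal_diag[OF A] by blast
  have Ut: "transpose_mat U \<in> carrier_mat n n" using U by simp
  have UUt: "U * transpose_mat U = 1\<^sub>m n"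
    by (rule mat_mult_left_right_inverse[OF Ut U(1,2)])
  have "U * (transpose_mat U * A * U) * transpose_mat U = (U * transpose_mat U) * A * (U * transpose_mat U)"
    using U(1) Ut A(1) by (simp add: assoc_mult_mat[of _ n n _ n _ n] mult_carrier_mat[of _ n n _ n])
  then have AU: "A = U * mat_diag n d * transpose_mat U" using U(3) UUt A(1) by simp
  have "similar_mat_wit A (mat_diag n d) U (transpose_mat U)"
    using U(1,2) UUt AU A(1) by (intro similar_mat_witI[of _ _ n]) auto
  then have "char_poly A = char_poly (mat_diag n d)"
    using char_poly_similar unfolding similar_mat_def by blast
  also have "\<dots> = (\<Prod>a\<leftarrow>diag_mat (mat_diag n d). [:- a, 1:])"
    by (rule char_poly_upper_triangular[of _ n]) (auto simp: mat_diag_def)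
  also have "diag_mat (mat_diag n d) = map d [0..<n]" by (simp add: diag_mat_def mat_diag_def)
  also have "(\<Prod>a\<leftarrow>map d [0..<n]. [:- a, 1:]) = (\<Prod>k<n. [:- d k, 1:])"
    by (simp add: comp_def prod.list_conv_set_nth lessThan_atLeast0)
  finally have "proots (char_poly A) = (\<Sum>k<n. proots [:- d k, 1:])"
    by (simp add: proots_prod)
  also have "\<dots> = image_mset d (mset_set {..<n})" by (induction n) (auto simp: lessThan_Suc)
  finally have roots: "proots (char_poly A) = image_mset d (mset_set {..<n})" .
  define u where "u k i = U $$ (i,k)" for k i
  have 1: "(\<Sum>i<n. u k i * u l i) = of_bool (k = l)" if "k < n" "l < n" for k l
  proof -
    have "(\<Sum>i<n. u k i * u l i) = (transpose_mat U * U) $$ (k,l)"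
      using that U(1) by (simp add: u_def scalar_prod_def lessThan_atLeast0)
    then show ?thesis using U(2) that by simp
  qed
  have 2: "(\<Sum>k<n. u k i * u k j) = of_bool (i = j)" if "i < n" "j < n" for i j
  proof -
    have "(\<Sum>k<n. u k i * u k j) = (U * transpose_mat U) $$ (i,j)"
      using that U(1) by (simp add: u_def scalar_prod_def lessThan_atLeast0)
    then show ?thesis using UUt that by simp
  qed
  have 3: "A $$ (i,j) = (\<Sum>k<n. d k * (u k i * u k j))" if "i < n" "j < n" for i j
    using that U(1) arg_cong[OF AU, of "\<lambda>M. M $$ (i,j)"]
    by (simp add: mat_diag_mult_right[of U n n] scalar_prod_def u_def lessThan_atLeast0 mult_ac)
  show ?thesis unfolding spectral_decomposition_def using 1 2 3 roots by blast
qed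

section \<open>Norms, quadratic forms and mixing in the coordinates of an eigenbasis\<close>

text \<open>Here and below \<open>u\<close> acts on the agent index only, while each
  \<open>x i\<close> is itself a vector. This replaces the Kronecker product of the matrix with an
  identity.\<close>

lemma parseval_sum:
  fixes x :: "nat \<Rightarrow> 'a::real_inner"
  assumes "\<And>i j. i < n \<Longrightarrow> j < n \<Longrightarrow> (\<Sum>k<n. u k i * u k j) = of_bool (i = j)"
  shows "(\<Sum>k<n. (norm (\<Sum>i<n. u k i *\<^sub>R x i))\<^sup>2) = (\<Sum>i<n. (norm (x i))\<^sup>2)"
proof -
  have "(\<Sum>k<n. (norm (\<Sum>i<n. u k i *\<^sub>R x i))\<^sup>2)
    = (\<Sum>k<n. \<Sum>i<n. \<Sum>j<n. u k i * u k j * inner (x i) (x j))"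
    by (simp add: power2_norm_eq_inner inner_sum_left inner_sum_right sum_distrib_left mult_ac)
      (simp add: inner_commute)
  also have "\<dots> = (\<Sum>i<n. \<Sum>k<n. \<Sum>j<n. u k i * u k j * inner (x i) (x j))" by (rule sum.swap)
  also have "\<dots> = (\<Sum>i<n. \<Sum>j<n. \<Sum>k<n. u k i * u k j * inner (x i) (x j))"
    by (intro sum.cong refl sum.swap)
  also have "\<dots> = (\<Sum>i<n. \<Sum>j<n. of_bool (i = j) * inner (x i) (x j))"
    by (simp add: sum_distrib_right[symmetric] assms)
  also have "\<dots> = (\<Sum>i<n. (norm (x i))\<^sup>2)"
    by (simp add: power2_norm_eq_inner if_distrib of_bool_def if_distribR sum.delta cong: if_cong)
  finally show ?thesis .
qed

lemma spectral_quadratic_form: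
  fixes x :: "nat \<Rightarrow> 'a::real_inner"
  assumes "\<And>i j. i < n \<Longrightarrow> j < n \<Longrightarrow> w i j = (\<Sum>k<n. d k * (u k i * u k j))"
  shows "(\<Sum>i<n. \<Sum>j<n. w i j * inner (x i) (x j))
    = (\<Sum>k<n. d k * (norm (\<Sum>i<n. u k i *\<^sub>R x i))\<^sup>2)"
proof -
  have "(\<Sum>i<n. \<Sum>j<n. w i j * inner (x i) (x j))
    = (\<Sum>i<n. \<Sum>j<n. \<Sum>k<n. d k * (u k i * u k j) * inner (x i) (x j))"
    by (simp add: assms sum_distrib_right)
  also have "\<dots> = (\<Sum>i<n. \<Sum>k<n. \<Sum>j<n. d k * (u k i * u k j) * inner (x i) (x j))"
    by (intro sum.cong refl sum.swap)
  also have "\<dots> = (\<Sum>k<n. \<Sum>i<n. \<Sum>j<n. d k * (u k i * u k j) * inner (x i) (x j))"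
    by (rule sum.swap)
  also have "\<dots> = (\<Sum>k<n. d k * (norm (\<Sum>i<n. u k i *\<^sub>R x i))\<^sup>2)"
    by (simp add: power2_norm_eq_inner inner_sum_left inner_sum_right sum_distrib_left mult_ac)
      (simp add: inner_commute)
  finally show ?thesis .
qed

text \<open>The expansion of \<open>w\<close> is symmetric in its two indices, so \<open>u k\<close>
  is also a left eigenvector, and mixing multiplies the \<open>k\<close>-th coefficient by
  \<open>d k\<close>.\<close>

lemma spectral_coefficient:
  fixes x :: "nat \<Rightarrow> 'a::real_vector"
  assumes orth: "\<And>k l. k < n \<Longrightarrow> l < n \<Longrightarrow> (\<Sum>i<n. u k i * u l i) = of_bool (k = l)"
    and w: "\<And>i j. i < n \<Longrightarrow> j < n \<Longrightarrow> w i j = (\<Sum>k<n. d k * (u k i * u k j))"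
    and k: "k < n"
  shows "(\<Sum>i<n. u k i *\<^sub>R (\<Sum>j<n. w i j *\<^sub>R x j)) = d k *\<^sub>R (\<Sum>j<n. u k j *\<^sub>R x j)"
proof -
  have uw: "(\<Sum>i<n. u k i * w i j) = d k * u k j" if "j < n" for j
  proof -
    have "(\<Sum>i<n. u k i * w i j) = (\<Sum>i<n. \<Sum>l<n. d l * u l j * (u k i * u l i))"
      using that by (simp add: w sum_distrib_left mult_ac)
    also have "\<dots> = (\<Sum>l<n. \<Sum>i<n. d l * u l j * (u k i * u l i))" by (rule sum.swap)
    also have "\<dots> = (\<Sum>l<n. d l * u l j * of_bool (k = l))"
      using k by (simp add: sum_distrib_left[symmetric] orth)
    also have "\<dots> = d k * u k j" using k by (simp add: of_bool_def if_distrib cong: if_cong)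
    finally show ?thesis .
  qed
  have "(\<Sum>i<n. u k i *\<^sub>R (\<Sum>j<n. w i j *\<^sub>R x j)) = (\<Sum>i<n. \<Sum>j<n. (u k i * w i j) *\<^sub>R x j)"
    by (simp add: scaleR_sum_right)
  also have "\<dots> = (\<Sum>j<n. \<Sum>i<n. (u k i * w i j) *\<^sub>R x j)" by (rule sum.swap)
  also have "\<dots> = (\<Sum>j<n. (d k * u k j) *\<^sub>R x j)" by (simp add: scaleR_sum_left[symmetric] uw)
  finally show ?thesis by (simp add: scaleR_sum_right)
qed

text \<open>
  In the second part, \<open>d l\<close> must be the largest eigenvalue, so every other index is bounded by the
  second entry of the sorted list; this is where multiplicities matter.
\<close>

lemma eigvals_desc_bounds:
  fixes A :: "real mat"
  assumes roots: "proots (char_poly A) = image_mset d (mset_set {..<n})" and k: "k < n"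
  shows "eigval A n \<le> d k"
    and "l < n \<Longrightarrow> l \<noteq> k \<Longrightarrow> d l > eigval A 2 \<Longrightarrow> d k \<le> eigval A 2"
proof -
  define ds where "ds = eigvals_desc A"
  have mset: "mset ds = image_mset d (mset_set {..<n})"
    by (simp add: ds_def eigvals_desc_def roots)
  have len: "length ds = n" using arg_cong[OF mset, of size] by simp
  have "sorted (rev ds)" by (simp add: ds_def eigvals_desc_def)
  then have desc: "ds ! j \<le> ds ! i" if "i \<le> j" "j < n" for i j
    using that len sorted_rev_nth_mono[of ds i j] by simp
  have "d k \<in># mset ds" using k by (simp add: mset)
  then obtain j where j: "j < n" "ds ! j = d k" using len by (auto simp: in_set_conv_nth)
  show "eigval A n \<le> d k" using desc[of j "n - 1"] j by (simp add: eigval_def ds_def[symmetric])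
  assume l: "l < n" "l \<noteq> k" "d l > eigval A 2"
  \<comment> \<open>Two distinct indices below \<open>n\<close> exist, so \<open>eigval A 2\<close>,
    which is entry 1 of the list, is within range.\<close>
  then have n: "1 < n" using k by linarith
  have "d l \<in># mset ds" using l by (simp add: mset)
  then obtain j where j: "j < n" "ds ! j = d l" using len by (auto simp: in_set_conv_nth)
  then have "j = 0"
    using desc[of 1 j] l(3) n by (cases j) (auto simp: eigval_def ds_def[symmetric])
  then obtain ts where ts: "ds = d l # ts" using j len by (cases ds) auto
  \<comment> \<open>One occurrence is removed, namely the one belonging to index \<open>l\<close>;
    the value of every other index stays in the tail.\<close>
  have "mset ts = image_mset d (mset_set ({..<n} - {l}))"
    using mset l(1) by (simp add: ts mset_set.remove[of _ l])
  then have "d k \<in># mset ts" using k l by simp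
  then obtain i where "i < length ts" "ts ! i = d k" by (auto simp: in_set_conv_nth)
  then have "d k = ds ! (Suc i)" "Suc i < n" using ts len by auto
  then show "d k \<le> eigval A 2" using desc[of 1 "Suc i"] by (simp add: eigval_def ds_def[symmetric])
qed

section \<open>Bounds on the mixing matrix from its extreme eigenvalues\<close>

lemma eigval_min_quadratic_form:
  fixes x :: "nat \<Rightarrow> 'a::real_inner" and W :: "real mat"
  assumes "W \<in> carrier_mat n n" "transpose_mat W = W"
  shows "eigval W n * (\<Sum>i<n. (norm (x i))\<^sup>2) \<le> (\<Sum>i<n. \<Sum>j<n. W $$ (i,j) * inner (x i) (x j))"
proof -
  obtain u d where "spectral_decomposition W n u d"
    using symmetric_mat_spectral[OF assms] by blast
  note u = spectral_decompositionD[OF this]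
  have parseval: "(\<Sum>k<n. (norm (\<Sum>i<n. u k i *\<^sub>R x i))\<^sup>2) = (\<Sum>i<n. (norm (x i))\<^sup>2)"
    by (rule parseval_sum) (rule u(2))
  have "eigval W n * (\<Sum>i<n. (norm (x i))\<^sup>2) = (\<Sum>k<n. eigval W n * (norm (\<Sum>i<n. u k i *\<^sub>R x i))\<^sup>2)"
    by (simp only: sum_distrib_left[symmetric] parseval)
  also have "\<dots> \<le> (\<Sum>k<n. d k * (norm (\<Sum>i<n. u k i *\<^sub>R x i))\<^sup>2)"
    by (intro sum_mono mult_right_mono eigvals_desc_bounds(1)[OF u(4)]) auto
  also have "\<dots> = (\<Sum>i<n. \<Sum>j<n. W $$ (i,j) * inner (x i) (x j))"
    by (rule spectral_quadratic_form[symmetric]) (rule u(3))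
  finally show ?thesis .
qed

text \<open>The gap makes 1 a simple eigenvalue, so mean zero removes exactly the component that is
  not damped. For \<open>n = 1\<close> the entry \<open>eigval W 2\<close> lies beyond the end of
  the list; then only the second case for \<open>k\<close> arises and \<open>c k\<close>
  vanishes.\<close>

lemma mixing_contraction:
  fixes y :: "nat \<Rightarrow> 'a::real_inner" and W :: "real mat"
  assumes W: "W \<in> carrier_mat n n" "transpose_mat W = W"
    and row_sum: "\<And>i. i < n \<Longrightarrow> (\<Sum>j<n. W $$ (i,j)) = 1"
    and gap: "eigval W 2 < 1"
    and y: "(\<Sum>i<n. y i) = 0"
  shows "(\<Sum>i<n. (norm (\<Sum>j<n. W $$ (i,j) *\<^sub>R y j))\<^sup>2)
    \<le> (max \<bar>eigval W 2\<bar> \<bar>eigval W n\<bar>)\<^sup>2 * (\<Sum>i<n. (norm (y i))\<^sup>2)"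
proof -
  define \<beta> where "\<beta> = max \<bar>eigval W 2\<bar> \<bar>eigval W n\<bar>"
  obtain u d where "spectral_decomposition W n u d"
    using symmetric_mat_spectral[OF W] by blast
  note u = spectral_decompositionD[OF this]
  \<comment> \<open>\<open>s\<close> collects the coefficients of the all-ones vector, an eigenvector for the eigenvalue 1. If \<open>s l \<noteq> 0\<close>
    for some \<open>l \<noteq> k\<close>, then \<open>d l = 1\<close> and the gap bounds \<open>d k\<close>; otherwise the \<open>k\<close>-th eigenvector is
    constant and \<open>y\<close> is orthogonal to it.\<close>
  define s where "s k = (\<Sum>i<n. u k i)" for k
  \<comment> \<open>Mixing fixes the all-ones vector because rows sum to 1, so its
    \<open>k\<close>-th coefficient satisfies this equation; a nonzero coefficient forces
    \<open>d k = 1\<close>.\<close>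
  have s: "s k = d k * s k" if "k < n" for k
    using spectral_coefficient[of n u "\<lambda>i j. W $$ (i,j)" d k "\<lambda>_. 1::real", OF u(1) u(3) that]
    by (simp add: row_sum s_def)
  have one: "(\<Sum>k<n. s k * u k i) = 1" if "i < n" for i
  proof -
    have "(\<Sum>k<n. s k * u k i) = (\<Sum>j<n. \<Sum>k<n. u k j * u k i)"
      unfolding s_def sum_distrib_right by (rule sum.swap)
    also have "\<dots> = 1" using that by (simp add: u(2) of_bool_def)
    finally show ?thesis .
  qed
  define c where "c k = (\<Sum>i<n. u k i *\<^sub>R y i)" for k
  have parseval: "(\<Sum>k<n. (norm (c k))\<^sup>2) = (\<Sum>i<n. (norm (y i))\<^sup>2)"
    unfolding c_def by (rule parseval_sum) (rule u(2))
  have coeff: "(norm (d k *\<^sub>R c k))\<^sup>2 \<le> \<beta>\<^sup>2 * (norm (c k))\<^sup>2" if k: "k < n" for k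
  proof (cases "\<exists>l<n. l \<noteq> k \<and> s l \<noteq> 0")
    case True
    then obtain l where l: "l < n" "l \<noteq> k" "s l \<noteq> 0" by blast
    then have "d l = 1" using s by force
    then have "d k \<le> eigval W 2" "eigval W n \<le> d k"
      using eigvals_desc_bounds[OF u(4) k] l gap by auto
    then have "\<bar>d k\<bar> \<le> \<beta>" unfolding \<beta>_def by linarith
    then have "\<bar>d k\<bar>\<^sup>2 \<le> \<beta>\<^sup>2" by (rule power_mono) simp
    then show ?thesis by (simp add: power_mult_distrib mult_right_mono)
  next
    case False
    then have zero: "s l = 0" if "l < n" "l \<noteq> k" for l using that by blast
    have su: "s k * u k i = 1" if "i < n" for i
    proof -
      have "(\<Sum>l<n. s l * u l i) = (\<Sum>l\<in>{k}. s l * u l i)"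
        using k zero by (intro sum.mono_neutral_right) auto
      then show ?thesis using one[OF that] by simp
    qed
    have "s k *\<^sub>R c k = (\<Sum>i<n. y i)" by (simp add: c_def scaleR_sum_right su)
    moreover have "s k \<noteq> 0" using su[OF k] by auto
    ultimately have "c k = 0" using y by simp
    then show ?thesis by simp
  qed
  have "(\<Sum>i<n. (norm (\<Sum>j<n. W $$ (i,j) *\<^sub>R y j))\<^sup>2) = (\<Sum>k<n. (norm (d k *\<^sub>R c k))\<^sup>2)"
  proof -
    have "(\<Sum>i<n. u k i *\<^sub>R (\<Sum>j<n. W $$ (i,j) *\<^sub>R y j)) = d k *\<^sub>R c k" if "k < n" for k
      unfolding c_def using spectral_coefficient[of n u "\<lambda>i j. W $$ (i,j)" d k y, OF u(1) u(3) that] .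
    then show ?thesis
      using parseval_sum[of n u "\<lambda>i. \<Sum>j<n. W $$ (i,j) *\<^sub>R y j", OF u(2)] by simp
  qed
  also have "\<dots> \<le> (\<Sum>k<n. \<beta>\<^sup>2 * (norm (c k))\<^sup>2)" by (intro sum_mono coeff) simp
  also have "\<dots> = \<beta>\<^sup>2 * (\<Sum>i<n. (norm (y i))\<^sup>2)"
    by (simp only: sum_distrib_left[symmetric] parseval)
  finally show ?thesis unfolding \<beta>_def .
qed

subsection \<open>Lipschitz and convex gradients\<close>

lemma GDERIV_along_line:
  fixes f :: "'a::real_inner \<Rightarrow> real"
  assumes "GDERIV f (x + t *\<^sub>R d) :> D"
  shows "((\<lambda>t. f (x + t *\<^sub>R d)) has_real_derivative inner d D) (at t)"
proof -
  have "((\<lambda>t. x + t *\<^sub>R d) has_derivative (\<lambda>h. 0 + h *\<^sub>R d)) (at t)"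
    by (intro has_derivative_add has_derivative_const has_derivative_scaleR_left has_derivative_ident)
  then have "((\<lambda>t. f (x + t *\<^sub>R d)) has_derivative (\<lambda>h. inner (0 + h *\<^sub>R d) D)) (at t)"
    using assms unfolding gderiv_def by (rule has_derivative_compose)
  then show ?thesis by (simp add: has_field_derivative_def mult_commute_abs)
qed

lemma lipschitz_gradient_upper_bound:
  fixes f :: "'a::real_inner \<Rightarrow> real"
  assumes grad: "\<And>x. GDERIV f x :> g x" and lip: "L-lipschitz_on UNIV g"
  shows "f y \<le> f x + inner (g x) (y - x) + L / 2 * (norm (y - x))\<^sup>2"
proof -
  define d where "d = y - x"
  \<comment> \<open>The difference between \<open>f\<close> on the segment and its quadratic model.
    Cauchy-Schwarz and the Lipschitz condition make it nonincreasing, and comparing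
    \<open>t = 0\<close> with \<open>t = 1\<close> gives the claim.\<close>
  define \<phi> where "\<phi> t = f (x + t *\<^sub>R d) - t * inner (g x) d - L / 2 * t\<^sup>2 * (norm d)\<^sup>2" for t
  have deriv: "(\<phi> has_real_derivative
      inner d (g (x + t *\<^sub>R d)) - inner (g x) d - L * t * (norm d)\<^sup>2) (at t)" for t
  proof -
    have "((\<lambda>t. t * inner (g x) d + L / 2 * t\<^sup>2 * (norm d)\<^sup>2) has_real_derivative
        inner (g x) d + L * t * (norm d)\<^sup>2) (at t)"
      by (auto intro!: derivative_eq_intros)
    from DERIV_diff[OF GDERIV_along_line[OF grad[of "x + t *\<^sub>R d"]] this] show ?thesis
      unfolding \<phi>_def by (simp only: diff_diff_eq)
  qed
  have "inner d (g (x + t *\<^sub>R d)) - inner (g x) d - L * t * (norm d)\<^sup>2 \<le> 0" if "0 \<le> t" for t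
  proof -
    have "inner d (g (x + t *\<^sub>R d) - g x) \<le> norm d * norm (g (x + t *\<^sub>R d) - g x)"
      by (rule norm_cauchy_schwarz)
    also have "\<dots> \<le> norm d * (L * norm (t *\<^sub>R d))"
      using lipschitz_onD[OF lip, of "x + t *\<^sub>R d" x] by (intro mult_left_mono) (auto simp: dist_norm)
    finally show ?thesis
      using that by (simp add: inner_diff_right inner_commute power2_eq_square mult_ac)
  qed
  then have "\<phi> 1 \<le> \<phi> 0"
    using deriv by (intro DERIV_nonpos_imp_nonincreasing[of 0 1 \<phi>]) (simp, blast)
  then show ?thesis by (simp add: \<phi>_def d_def)
qed

text \<open>A gradient step of length \<open>1 / L\<close> lowers \<open>f\<close> by at least
  \<open>(norm (g x))\<^sup>2 / (2 * L)\<close>, yet cannot go below \<open>m\<close>. With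
  \<open>m\<close> the minimal value it also shows that the gradient vanishes at a
  minimizer.\<close>

lemma gradient_bound_gap:
  fixes f :: "'a::real_inner \<Rightarrow> real"
  assumes grad: "\<And>x. GDERIV f x :> g x" and lip: "L-lipschitz_on UNIV g" and "L > 0"
    and lower: "\<And>x. m \<le> f x"
  shows "(norm (g x))\<^sup>2 \<le> 2 * L * (f x - m)"
proof -
  have "m \<le> f (x - (1 / L) *\<^sub>R g x)" by (rule lower)
  also have "\<dots> \<le> f x - (norm (g x))\<^sup>2 / (2 * L)"
    using lipschitz_gradient_upper_bound[OF grad lip, of "x - (1 / L) *\<^sub>R g x" x] \<open>L > 0\<close>
    by (simp add: power2_norm_eq_inner[symmetric] field_simps power2_eq_square)
  finally show ?thesis using \<open>L > 0\<close> by (simp add: field_simps)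
qed

text \<open>By convexity the difference quotients along the segment never exceed
  \<open>f y - f x\<close>; let the step tend to 0 from the right.\<close>

lemma convex_gradient_lower_bound:
  fixes f :: "'a::real_inner \<Rightarrow> real"
  assumes conv: "convex_on UNIV f" and grad: "GDERIV f x :> D"
  shows "f x + inner D (y - x) \<le> f y"
proof -
  define d where "d = y - x"
  have "((\<lambda>t. f (x + t *\<^sub>R d)) has_real_derivative inner d D) (at 0)"
    using grad by (intro GDERIV_along_line) simp
  then have "((\<lambda>t. (f (x + t *\<^sub>R d) - f x) / t) \<longlongrightarrow> inner d D) (at 0)"
    by (simp add: has_field_derivative_iff)
  then have "((\<lambda>t. (f (x + t *\<^sub>R d) - f x) / t) \<longlongrightarrow> inner d D) (at_right 0)"
    by (rule tendsto_mono[rotated]) (simp add: at_within_le_at)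
  moreover have "\<forall>\<^sub>F t in at_right 0. (f (x + t *\<^sub>R d) - f x) / t \<le> f y - f x"
    unfolding eventually_at_right_field
  proof (intro exI[of _ 1] conjI allI impI)
    fix t :: real assume t: "0 < t" "t < 1"
    have "f ((1 - t) *\<^sub>R x + t *\<^sub>R y) \<le> (1 - t) * f x + t * f y"
      using t by (intro convex_onD[OF conv]) auto
    moreover have "(1 - t) *\<^sub>R x + t *\<^sub>R y = x + t *\<^sub>R d" by (simp add: d_def algebra_simps)
    ultimately show "(f (x + t *\<^sub>R d) - f x) / t \<le> f y - f x" using t by (simp add: field_simps)
  qed simp
  ultimately have "inner d D \<le> f y - f x"
    by (rule tendsto_upperbound) simp
  then show ?thesis by (simp add: d_def inner_commute)
qed

lemma cocoercive_at_minimum: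
  fixes f :: "'a::real_inner \<Rightarrow> real"
  assumes grad: "\<And>x. GDERIV f x :> g x" and lip: "L-lipschitz_on UNIV g" and "L > 0"
    and conv: "convex_on UNIV f" and min: "\<And>x. f z \<le> f x"
  shows "(norm (g x))\<^sup>2 \<le> L * inner (g x) (x - z)"
proof -
  have "g z = 0" using gradient_bound_gap[OF grad lip \<open>L > 0\<close> min, of z] by simp
  \<comment> \<open>This point maximizes the linear lower bound at \<open>x\<close> minus the
    quadratic upper bound at \<open>z\<close>, so squeezing \<open>f y\<close> between the two gives
    the sharpest estimate.\<close>
  define y where "y = z + (1 / L) *\<^sub>R g x"
  have "f x + inner (g x) (y - x) \<le> f y" by (rule convex_gradient_lower_bound[OF conv grad])
  also have "\<dots> \<le> f z + L / 2 * (norm (y - z))\<^sup>2"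
    using lipschitz_gradient_upper_bound[OF grad lip, of y z] \<open>g z = 0\<close> by simp
  also have "L / 2 * (norm (y - z))\<^sup>2 = (norm (g x))\<^sup>2 / (2 * L)"
    using \<open>L > 0\<close> by (simp add: y_def field_simps power2_eq_square)
  finally have "f x - f z \<le> inner (g x) (x - y) + (norm (g x))\<^sup>2 / (2 * L)"
    by (simp add: inner_diff_right)
  moreover have "inner (g x) (x - y) = inner (g x) (x - z) - (norm (g x))\<^sup>2 / L"
    by (simp add: y_def inner_diff_right inner_add_right power2_norm_eq_inner)
  moreover have "(norm (g x))\<^sup>2 / (2 * L) \<le> f x - f z"
    using gradient_bound_gap[OF grad lip \<open>L > 0\<close> min, of x] \<open>L > 0\<close> by (simp add: field_simps)
  ultimately have "(norm (g x))\<^sup>2 / L \<le> inner (g x) (x - z)" by (simp add: field_simps)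
  then show ?thesis using \<open>L > 0\<close> by (simp add: field_simps)
qed

text \<open>
  The factor is \<open>1 - \<alpha> c\<close> rather than \<open>1 - 2 \<alpha> c\<close>: half of the term \<open>2 \<alpha> \<langle>p, d\<rangle>\<close> absorbs \<open>\<alpha>\<^sup>2 \<parallel>p\<parallel>\<^sup>2\<close>, so
  the joint coercivity inequality with \<open>c\<^sub>1\<close> and \<open>c\<^sub>2\<close> is not needed, and both convexity assumptions are
  treated alike.
\<close>

lemma gradient_step_contraction:
  fixes d p :: "'a::real_inner"
  assumes mono: "m * (norm d)\<^sup>2 \<le> inner p d" and coco: "(norm p)\<^sup>2 \<le> L * inner p d"
    and "0 < \<alpha>" "0 \<le> m" "\<alpha> * L \<le> 1" "c \<le> m"
  shows "(norm (d - \<alpha> *\<^sub>R p))\<^sup>2 \<le> (1 - \<alpha> * c) * (norm d)\<^sup>2"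
proof -
  have pd: "0 \<le> inner p d" using mono \<open>0 \<le> m\<close> by (smt (verit) mult_nonneg_nonneg zero_le_power2)
  have "\<alpha> * (norm p)\<^sup>2 \<le> \<alpha> * L * inner p d"
    using coco \<open>0 < \<alpha>\<close> by (simp add: mult.assoc)
  also have "\<dots> \<le> inner p d" using mult_right_mono[OF \<open>\<alpha> * L \<le> 1\<close> pd] by simp
  finally have "\<alpha> * (norm p)\<^sup>2 - 2 * inner p d \<le> - inner p d" by simp
  also have "\<dots> \<le> - (c * (norm d)\<^sup>2)"
    using mono mult_right_mono[OF \<open>c \<le> m\<close>, of "(norm d)\<^sup>2"] by simp
  finally have "\<alpha> * (\<alpha> * (norm p)\<^sup>2 - 2 * inner p d) \<le> \<alpha> * - (c * (norm d)\<^sup>2)"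
    using \<open>0 < \<alpha>\<close> by (simp only: mult_le_cancel_left_pos)
  moreover have "(norm (d - \<alpha> *\<^sub>R p))\<^sup>2 = (norm d)\<^sup>2 + \<alpha> * (\<alpha> * (norm p)\<^sup>2 - 2 * inner p d)"
    by (simp add: power2_norm_eq_inner inner_diff_left inner_diff_right inner_commute algebra_simps)
  ultimately show ?thesis by (simp add: algebra_simps)
qed

section \<open>Recursions with an error term\<close>

lemma norm_add_sq_le_weighted:
  fixes a b :: "'a::real_inner"
  assumes "\<epsilon> > 0"
  shows "(norm (a + b))\<^sup>2 \<le> (1 + \<epsilon>) * (norm a)\<^sup>2 + (1 + inverse \<epsilon>) * (norm b)\<^sup>2"
proof -
  have "0 \<le> inverse \<epsilon> * (norm (\<epsilon> *\<^sub>R a - b))\<^sup>2" using assms by simp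
  also have "\<dots> = \<epsilon> * (norm a)\<^sup>2 - 2 * inner a b + inverse \<epsilon> * (norm b)\<^sup>2"
    unfolding power2_norm_eq_inner using assms
    by (simp add: inner_diff_left inner_diff_right inner_commute field_simps)
  finally show ?thesis
    by (simp add: power2_norm_eq_inner inner_add_left inner_add_right inner_commute algebra_simps)
qed

text \<open>Iterating the squares avoids accumulating cross terms; the square root is split into two
  summands only at the end.\<close>

lemma affine_square_recursion_bound:
  fixes e :: "nat \<Rightarrow> real"
  assumes step: "\<And>k. (e (Suc k))\<^sup>2 \<le> q\<^sup>2 * (e k)\<^sup>2 + r\<^sup>2"
    and "0 \<le> q" "q < 1" "0 \<le> r" "0 \<le> e 0"
  shows "e k \<le> q ^ k * e 0 + r / sqrt (1 - q\<^sup>2)"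
proof -
  \<comment> \<open>\<open>s\<^sup>2\<close> is the fixed point of the map \<open>t\<close> to
    \<open>q\<^sup>2 * t + r\<^sup>2\<close>.\<close>
  define s where "s = r / sqrt (1 - q\<^sup>2)"
  have q: "q\<^sup>2 < 1" using assms by (simp add: power_less_one_iff)
  have s: "q\<^sup>2 * s\<^sup>2 + r\<^sup>2 = s\<^sup>2" using q by (simp add: s_def power_divide field_simps)
  have "(e k)\<^sup>2 \<le> (q ^ k * e 0)\<^sup>2 + s\<^sup>2"
  proof (induction k)
    case (Suc k)
    have "(e (Suc k))\<^sup>2 \<le> q\<^sup>2 * (e k)\<^sup>2 + r\<^sup>2" by (rule step)
    also have "\<dots> \<le> q\<^sup>2 * ((q ^ k * e 0)\<^sup>2 + s\<^sup>2) + r\<^sup>2"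
      using Suc by (intro add_right_mono mult_left_mono) auto
    also have "\<dots> = (q ^ Suc k * e 0)\<^sup>2 + s\<^sup>2"
      using s by (simp add: algebra_simps power_mult_distrib)
    finally show ?case .
  qed simp
  also have "\<dots> \<le> (q ^ k * e 0 + s)\<^sup>2"
  proof -
    have "0 \<le> s" using q \<open>0 \<le> r\<close> by (simp add: s_def)
    then show ?thesis using assms by (simp add: power2_sum)
  qed
  finally have "e k \<le> q ^ k * e 0 + s"
    by (rule power2_le_imp_le) (use assms q in \<open>simp add: s_def\<close>)
  then show ?thesis by (simp add: s_def)
qed

subsection \<open>Decentralized gradient descent\<close>

text \<open>Bound each inner product by half the sum of the squared norms and use that rows and
  columns sum to 1. This makes the quadratic part of the energy nonnegative.\<close>

lemma stochastic_form_le: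
  fixes x :: "nat \<Rightarrow> 'a::real_inner"
  assumes nonneg: "\<And>i j. i < n \<Longrightarrow> j < n \<Longrightarrow> 0 \<le> w i j"
    and row: "\<And>i. i < n \<Longrightarrow> (\<Sum>j<n. w i j) = 1" and col: "\<And>j. j < n \<Longrightarrow> (\<Sum>i<n. w i j) = 1"
  shows "(\<Sum>i<n. \<Sum>j<n. w i j * inner (x i) (x j)) \<le> (\<Sum>i<n. (norm (x i))\<^sup>2)"
proof -
  have "inner a b \<le> ((norm a)\<^sup>2 + (norm b)\<^sup>2) / 2" for a b :: 'a
    using zero_le_power2[of "norm (a - b)"]
    by (simp add: power2_norm_eq_inner inner_diff_left inner_diff_right inner_commute)
  then have "(\<Sum>i<n. \<Sum>j<n. w i j * inner (x i) (x j))
      \<le> (\<Sum>i<n. \<Sum>j<n. w i j * (((norm (x i))\<^sup>2 + (norm (x j))\<^sup>2) / 2))"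
    by (intro sum_mono mult_left_mono nonneg) auto
  also have "\<dots> = ((\<Sum>i<n. \<Sum>j<n. w i j * (norm (x i))\<^sup>2) + (\<Sum>i<n. \<Sum>j<n. w i j * (norm (x j))\<^sup>2)) / 2"
    by (simp add: sum.distrib distrib_left add_divide_distrib sum_divide_distrib)
  also have "(\<Sum>i<n. \<Sum>j<n. w i j * (norm (x i))\<^sup>2) = (\<Sum>i<n. (norm (x i))\<^sup>2)"
    by (simp add: sum_distrib_right[symmetric] row)
  also have "(\<Sum>i<n. \<Sum>j<n. w i j * (norm (x j))\<^sup>2) = (\<Sum>j<n. \<Sum>i<n. w i j * (norm (x j))\<^sup>2)"
    by (rule sum.swap)
  also have "\<dots> = (\<Sum>i<n. (norm (x i))\<^sup>2)"
    by (simp add: sum_distrib_right[symmetric] col)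
  finally show ?thesis by simp
qed

lemma symmetric_form_add:
  fixes x d :: "nat \<Rightarrow> 'a::real_inner"
  assumes sym: "\<And>i j. i < n \<Longrightarrow> j < n \<Longrightarrow> w i j = w j i"
  shows "(\<Sum>i<n. \<Sum>j<n. w i j * inner (x i + d i) (x j + d j))
    = (\<Sum>i<n. \<Sum>j<n. w i j * inner (x i) (x j)) + 2 * (\<Sum>i<n. inner (\<Sum>j<n. w i j *\<^sub>R x j) (d i))
      + (\<Sum>i<n. \<Sum>j<n. w i j * inner (d i) (d j))"
proof -
  have 1: "(\<Sum>i<n. \<Sum>j<n. w i j * inner (d i) (x j)) = (\<Sum>i<n. inner (\<Sum>j<n. w i j *\<^sub>R x j) (d i))"
    by (simp add: inner_sum_left inner_sum_right inner_commute)
  have "(\<Sum>i<n. \<Sum>j<n. w i j * inner (x i) (d j)) = (\<Sum>j<n. \<Sum>i<n. w i j * inner (x i) (d j))"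
    by (rule sum.swap)
  also have "\<dots> = (\<Sum>i<n. \<Sum>j<n. w i j * inner (d i) (x j))"
    by (intro sum.cong refl) (simp add: sym inner_commute)
  finally have 2: "(\<Sum>i<n. \<Sum>j<n. w i j * inner (x i) (d j)) = (\<Sum>i<n. inner (\<Sum>j<n. w i j *\<^sub>R x j) (d i))"
    using 1 by simp
  show ?thesis
    by (simp add: inner_add_left inner_add_right distrib_left sum.distrib 1 2)
qed

text \<open>Subtracting the mean is an orthogonal projection.\<close>

lemma sum_norm_sq_diff_mean_le:
  fixes x :: "nat \<Rightarrow> 'a::real_inner" and n :: nat
  defines "m \<equiv> (1 / real n) *\<^sub>R (\<Sum>i<n. x i)"
  shows "(\<Sum>i<n. (norm (x i - m))\<^sup>2) \<le> (\<Sum>i<n. (norm (x i))\<^sup>2)"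
proof (cases "n = 0")
  case False
  then have sum: "(\<Sum>i<n. x i) = real n *\<^sub>R m" by (simp add: m_def)
  have "(\<Sum>i<n. (norm (x i - m))\<^sup>2)
      = (\<Sum>i<n. (norm (x i))\<^sup>2) - 2 * inner (\<Sum>i<n. x i) m + real n * (norm m)\<^sup>2"
  proof -
    have "(norm (x i - m))\<^sup>2 = (norm (x i))\<^sup>2 - 2 * inner (x i) m + (norm m)\<^sup>2" for i
      by (simp add: power2_norm_eq_inner inner_diff_left inner_diff_right inner_commute)
    then show ?thesis by (simp add: sum.distrib sum_subtractf inner_sum_left sum_distrib_left)
  qed
  also have "\<dots> = (\<Sum>i<n. (norm (x i))\<^sup>2) - real n * (norm m)\<^sup>2"
    by (simp add: sum power2_norm_eq_inner)
  also have "\<dots> \<le> (\<Sum>i<n. (norm (x i))\<^sup>2)" by simp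
  finally show ?thesis .
qed simp

text \<open>Every summand is at most the Euclidean norm of the family, hence so is the average. The
  sharper factor \<open>1 / sqrt n\<close> is given away.\<close>

lemma norm_mean_le_L2_set:
  fixes x :: "nat \<Rightarrow> 'a::real_normed_vector"
  shows "norm ((1 / real n) *\<^sub>R (\<Sum>i<n. x i)) \<le> L2_set (\<lambda>i. norm (x i)) {..<n}"
proof (cases "n = 0")
  case False
  have "norm (\<Sum>i<n. x i) \<le> (\<Sum>i<n. norm (x i))" by (rule norm_sum)
  also have "\<dots> \<le> (\<Sum>i<n. L2_set (\<lambda>i. norm (x i)) {..<n})"
    by (intro sum_mono member_le_L2_set) auto
  finally show ?thesis using False by (simp add: field_simps)
qed (simp add: L2_set_nonneg)

section \<open>Energy decrease and the uniform gradient bound\<close>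

locale dgd_network =
  fixes n :: nat and W :: "real mat" and \<alpha> Lh \<beta> :: real
    and f :: "nat \<Rightarrow> 'a::euclidean_space \<Rightarrow> real" and L :: "nat \<Rightarrow> real"
  assumes W_carrier: "W \<in> carrier_mat n n" and W_sym: "transpose_mat W = W"
    and W_stoch: "doubly_stochastic n W"
    and \<beta>_eq: "\<beta> = max \<bar>eigval W 2\<bar> \<bar>eigval W n\<bar>" and \<beta>_less: "\<beta> < 1"
    and n_pos: "0 < n"
    and f_diff: "\<And>i. i < n \<Longrightarrow> f i differentiable_on UNIV"
    and f_bounded: "\<And>i. i < n \<Longrightarrow> bdd_below (range (f i))"
    and f_lipschitz: "\<And>i. i < n \<Longrightarrow> (L i)-lipschitz_on UNIV (grad (f i))"
    and L_pos: "\<And>i. i < n \<Longrightarrow> 0 < L i" and L_le: "\<And>i. i < n \<Longrightarrow> L i \<le> Lh"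
    and \<alpha>_pos: "0 < \<alpha>" and step_le: "\<alpha> * Lh \<le> 1 + eigval W n"
begin

lemma GDERIV_grad: "i < n \<Longrightarrow> GDERIV (f i) x :> grad (f i) x"
  using f_diff by (intro gderiv_grad) (auto simp: differentiable_on_def)

lemma Lh_pos: "0 < Lh"
  using L_pos[OF n_pos] L_le[OF n_pos] by simp

lemma \<beta>_nonneg: "0 \<le> \<beta>"
  unfolding \<beta>_eq by simp

lemma W_entry_sym: "i < n \<Longrightarrow> j < n \<Longrightarrow> W $$ (i,j) = W $$ (j,i)"
  using W_carrier W_sym by (metis carrier_matD index_transpose_mat(1))

lemma W_row: "i < n \<Longrightarrow> (\<Sum>j<n. W $$ (i,j)) = 1"
  and W_col: "j < n \<Longrightarrow> (\<Sum>i<n. W $$ (i,j)) = 1"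
  and W_nonneg: "i < n \<Longrightarrow> j < n \<Longrightarrow> 0 \<le> W $$ (i,j)"
  using W_stoch by (auto simp: doubly_stochastic_def)

lemma grad_descent_bound:
  assumes "i < n"
  shows "f i y \<le> f i x + inner (grad (f i) x) (y - x) + Lh / 2 * (norm (y - x))\<^sup>2"
proof -
  have "f i y \<le> f i x + inner (grad (f i) x) (y - x) + L i / 2 * (norm (y - x))\<^sup>2"
    using assms by (intro lipschitz_gradient_upper_bound GDERIV_grad f_lipschitz)
  also have "L i / 2 * (norm (y - x))\<^sup>2 \<le> Lh / 2 * (norm (y - x))\<^sup>2"
    using L_le[OF assms] by (intro mult_right_mono) auto
  finally show ?thesis by simp
qed

lemma opt_value_le: "i < n \<Longrightarrow> opt_value (f i) \<le> f i x"
  unfolding opt_value_def using f_bounded by (intro cINF_lower) auto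

definition energy :: "(nat \<Rightarrow> 'a) \<Rightarrow> real" where
  "energy x = ((\<Sum>i<n. (norm (x i))\<^sup>2) - (\<Sum>i<n. \<Sum>j<n. W $$ (i,j) * inner (x i) (x j))) / 2
    + \<alpha> * (\<Sum>i<n. f i (x i))"

lemma energy_dgd_Suc_le: "energy (dgd n W \<alpha> f (Suc k)) \<le> energy (dgd n W \<alpha> f k)"
proof -
  define x where "x = dgd n W \<alpha> f k"
  define w where "w i = (\<Sum>j<n. W $$ (i,j) *\<^sub>R x j)" for i
  define g where "g i = grad (f i) (x i)" for i
  \<comment> \<open>\<open>d\<close> is minus the gradient of \<open>energy\<close> at
    \<open>x\<close>, so the update is a unit step of gradient descent.\<close>
  define d where "d i = w i - x i - \<alpha> *\<^sub>R g i" for i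
  define S where "S = (\<Sum>i<n. (norm (d i))\<^sup>2)"
  have next_x: "dgd n W \<alpha> f (Suc k) = (\<lambda>i. x i + d i)"
    by (simp add: x_def d_def w_def g_def fun_eq_iff)
  have form: "(\<Sum>i<n. \<Sum>j<n. W $$ (i,j) * inner (x i + d i) (x j + d j))
    = (\<Sum>i<n. \<Sum>j<n. W $$ (i,j) * inner (x i) (x j)) + 2 * (\<Sum>i<n. inner (w i) (d i))
      + (\<Sum>i<n. \<Sum>j<n. W $$ (i,j) * inner (d i) (d j))"
    unfolding w_def by (rule symmetric_form_add) (rule W_entry_sym)
  have form_d: "eigval W n * S \<le> (\<Sum>i<n. \<Sum>j<n. W $$ (i,j) * inner (d i) (d j))"
    unfolding S_def by (rule eigval_min_quadratic_form[OF W_carrier W_sym])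
  have norms: "(\<Sum>i<n. (norm (x i + d i))\<^sup>2) = (\<Sum>i<n. (norm (x i))\<^sup>2) + 2 * (\<Sum>i<n. inner (x i) (d i)) + S"
    by (simp add: S_def power2_norm_eq_inner inner_add_left inner_add_right inner_commute
        sum.distrib sum_distrib_left algebra_simps)
  have "(\<Sum>i<n. f i (x i + d i)) \<le> (\<Sum>i<n. f i (x i) + inner (g i) (d i) + Lh / 2 * (norm (d i))\<^sup>2)"
  proof (rule sum_mono)
    fix i assume "i \<in> {..<n}"
    then show "f i (x i + d i) \<le> f i (x i) + inner (g i) (d i) + Lh / 2 * (norm (d i))\<^sup>2"
      using grad_descent_bound[of i "x i + d i" "x i"] by (simp add: g_def)
  qed
  also have "\<dots> = (\<Sum>i<n. f i (x i)) + (\<Sum>i<n. inner (g i) (d i)) + Lh / 2 * S"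
    by (simp add: sum.distrib sum_distrib_left S_def)
  finally have "\<alpha> * (\<Sum>i<n. f i (x i + d i))
      \<le> \<alpha> * ((\<Sum>i<n. f i (x i)) + (\<Sum>i<n. inner (g i) (d i)) + Lh / 2 * S)"
    using \<alpha>_pos by (simp only: mult_le_cancel_left_pos)
  then have f_step: "\<alpha> * (\<Sum>i<n. f i (x i + d i))
      \<le> \<alpha> * (\<Sum>i<n. f i (x i)) + \<alpha> * (\<Sum>i<n. inner (g i) (d i)) + \<alpha> * Lh * S / 2"
    by (simp add: distrib_left mult.assoc)
  have cross: "(\<Sum>i<n. inner (x i) (d i)) - (\<Sum>i<n. inner (w i) (d i)) + \<alpha> * (\<Sum>i<n. inner (g i) (d i)) = - S"
  proof -
    have "inner (x i) (d i) - inner (w i) (d i) + \<alpha> * inner (g i) (d i) = - (norm (d i))\<^sup>2" for i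
    proof -
      have "inner (x i) (d i) - inner (w i) (d i) + \<alpha> * inner (g i) (d i) = inner (- d i) (d i)"
        unfolding d_def by (simp only: minus_diff_eq inner_diff_left inner_scaleR_left)
      then show ?thesis by (simp add: power2_norm_eq_inner)
    qed
    then show ?thesis
      by (simp add: S_def sum_distrib_left sum_subtractf[symmetric] sum.distrib[symmetric] sum_negf[symmetric])
  qed
  \<comment> \<open>The linear terms contribute \<open>- S\<close> and the second-order terms at
    most \<open>(1 - eigval W n + \<alpha> * Lh) * S / 2\<close>. The stepsize bound makes the
    latter at most \<open>S\<close>.\<close>
  have "\<alpha> * Lh * S \<le> (1 + eigval W n) * S"
    by (intro mult_right_mono step_le) (simp add: S_def sum_nonneg)
  then have "\<alpha> * Lh * S \<le> S + eigval W n * S" by (simp add: distrib_right)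
  \<comment> \<open>The energy comparison with all sums abstracted to real variables:
    \<open>c\<close> stands for \<open>\<alpha> * Lh * S\<close>, \<open>l\<close> for
    \<open>eigval W n * S\<close> and \<open>Q\<close> for the form at \<open>d\<close>.\<close>
  moreover have "(N + 2 * X + S - (B + 2 * Y + Q)) / 2 + a \<le> (N - B) / 2 + b"
    if "c \<le> S + l" "l \<le> Q" "a \<le> b + G + c / 2" "X - Y + G = - S" for N X Y B Q a b c l G :: real
    using that by (simp add: field_simps)
  ultimately show ?thesis
    unfolding next_x energy_def x_def[symmetric] form norms
    using form_d f_step cross by blast
qed

text \<open>The quadratic part of the energy is nonnegative everywhere and vanishes at the initial
  point 0, so energy decrease bounds the function values alone.\<close>

lemma sum_f_dgd_le: "(\<Sum>i<n. f i (dgd n W \<alpha> f k i)) \<le> (\<Sum>i<n. f i 0)"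
proof -
  have "\<alpha> * (\<Sum>i<n. f i (dgd n W \<alpha> f k i)) \<le> energy (dgd n W \<alpha> f k)"
    unfolding energy_def using stochastic_form_le[of n "\<lambda>i j. W $$ (i,j)", OF W_nonneg W_row W_col]
    by simp
  also have "\<dots> \<le> energy (dgd n W \<alpha> f 0)"
  proof (induction k)
    case (Suc k)
    show ?case by (rule order_trans[OF energy_dgd_Suc_le Suc.IH])
  qed simp
  also have "\<dots> = \<alpha> * (\<Sum>i<n. f i 0)" by (simp add: energy_def)
  finally show ?thesis using \<alpha>_pos by simp
qed

definition D :: real where
  "D = sqrt (2 * Lh * (\<Sum>i<n. f i 0 - opt_value (f i)))"

lemma D_nonneg: "0 \<le> D"
  unfolding D_def using Lh_pos opt_value_le by (auto intro!: mult_nonneg_nonneg sum_nonneg)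

text \<open>Only the sum of the function values is controlled, since a single \<open>f i\<close> may
  increase. Each \<open>L i\<close> is therefore replaced by the common \<open>Lh\<close> before
  summing.\<close>

lemma sum_norm_sq_grad_le: "(\<Sum>i<n. (norm (grad (f i) (dgd n W \<alpha> f k i)))\<^sup>2) \<le> D\<^sup>2"
proof -
  define x where "x = dgd n W \<alpha> f k"
  have "(\<Sum>i<n. (norm (grad (f i) (x i)))\<^sup>2) \<le> (\<Sum>i<n. 2 * Lh * (f i (x i) - opt_value (f i)))"
  proof (rule sum_mono)
    fix i assume "i \<in> {..<n}"
    then have i: "i < n" by simp
    have "(norm (grad (f i) (x i)))\<^sup>2 \<le> 2 * L i * (f i (x i) - opt_value (f i))"
      using i by (intro gradient_bound_gap GDERIV_grad f_lipschitz L_pos opt_value_le)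
    also have "\<dots> \<le> 2 * Lh * (f i (x i) - opt_value (f i))"
      using L_le[OF i] opt_value_le[OF i] by (intro mult_right_mono) auto
    finally show "(norm (grad (f i) (x i)))\<^sup>2 \<le> 2 * Lh * (f i (x i) - opt_value (f i))" .
  qed
  also have "\<dots> = 2 * Lh * ((\<Sum>i<n. f i (x i)) - (\<Sum>i<n. opt_value (f i)))"
    by (simp add: sum_distrib_left sum_subtractf right_diff_distrib)
  also have "\<dots> \<le> 2 * Lh * ((\<Sum>i<n. f i 0) - (\<Sum>i<n. opt_value (f i)))"
    using sum_f_dgd_le[of k] Lh_pos by (simp add: x_def)
  also have "\<dots> = 2 * Lh * (\<Sum>i<n. f i 0 - opt_value (f i))" by (simp add: sum_subtractf)
  also have "\<dots> = D\<^sup>2"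
    unfolding D_def using Lh_pos opt_value_le
    by (intro real_sqrt_pow2[symmetric] mult_nonneg_nonneg sum_nonneg) auto
  finally show ?thesis by (simp add: x_def)
qed

section \<open>Consensus and the dynamics of the mean\<close>

text \<open>Each gradient is taken at its own agent's iterate. The gradient of the averaged
  objective at the mean differs from this by the error bounded in
  \<open>mean_grad_deviation\<close>.\<close>

definition mean_grad :: "nat \<Rightarrow> 'a" where
  "mean_grad k = (1 / real n) *\<^sub>R (\<Sum>i<n. grad (f i) (dgd n W \<alpha> f k i))"

lemma dgd_mean_Suc: "dgd_mean n W \<alpha> f (Suc k) = dgd_mean n W \<alpha> f k - \<alpha> *\<^sub>R mean_grad k"
proof -
  have "(\<Sum>i<n. \<Sum>j<n. W $$ (i,j) *\<^sub>R dgd n W \<alpha> f k j) = (\<Sum>j<n. \<Sum>i<n. W $$ (i,j) *\<^sub>R dgd n W \<alpha> f k j)"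
    by (rule sum.swap)
  also have "\<dots> = (\<Sum>j<n. dgd n W \<alpha> f k j)"
    by (simp add: scaleR_sum_left[symmetric] W_col)
  finally show ?thesis
    by (simp add: dgd_mean_def mean_grad_def sum_subtractf scaleR_diff_right scaleR_sum_right[symmetric] mult.commute)
qed

text \<open>Mixing shrinks the deviation by \<open>\<beta>\<close> and the gradients add at most
  \<open>\<alpha> * D\<close>. The bound is the fixed point of this recursion, which starts at 0.
  The contraction holds for all agents jointly, hence \<open>L2_set\<close>.\<close>

lemma consensus_bound:
  "L2_set (\<lambda>i. norm (dgd n W \<alpha> f k i - dgd_mean n W \<alpha> f k)) {..<n} \<le> \<alpha> * D / (1 - \<beta>)"
proof (induction k)
  case 0
  then show ?case
    using \<alpha>_pos D_nonneg \<beta>_less by (simp add: dgd_mean_def L2_set_def)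
next
  case (Suc k)
  define x where "x = dgd n W \<alpha> f k"
  define g where "g i = grad (f i) (x i)" for i
  define y where "y i = x i - dgd_mean n W \<alpha> f k" for i
  have "(\<Sum>i<n. y i) = 0"
    using n_pos by (simp add: y_def x_def dgd_mean_def sum_subtractf sum_constant_scaleR)
  moreover have "eigval W 2 < 1" using \<beta>_eq \<beta>_less by linarith
  ultimately have "(\<Sum>i<n. (norm (\<Sum>j<n. W $$ (i,j) *\<^sub>R y j))\<^sup>2) \<le> \<beta>\<^sup>2 * (\<Sum>i<n. (norm (y i))\<^sup>2)"
    unfolding \<beta>_eq by (intro mixing_contraction W_carrier W_sym W_row)
  then have "L2_set (\<lambda>i. norm (\<Sum>j<n. W $$ (i,j) *\<^sub>R y j)) {..<n} \<le> sqrt (\<beta>\<^sup>2 * (\<Sum>i<n. (norm (y i))\<^sup>2))"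
    unfolding L2_set_def by (rule real_sqrt_le_mono)
  also have "\<dots> = \<beta> * L2_set (\<lambda>i. norm (y i)) {..<n}"
    using \<beta>_nonneg by (simp add: L2_set_def real_sqrt_mult)
  also have "\<dots> \<le> \<beta> * (\<alpha> * D / (1 - \<beta>))"
    unfolding y_def x_def using Suc \<beta>_nonneg by (rule mult_left_mono)
  finally have mixed: "L2_set (\<lambda>i. norm (\<Sum>j<n. W $$ (i,j) *\<^sub>R y j)) {..<n} \<le> \<beta> * (\<alpha> * D / (1 - \<beta>))" .
  have "(\<Sum>i<n. (norm (g i - mean_grad k))\<^sup>2) \<le> D\<^sup>2"
    using sum_norm_sq_diff_mean_le[of g n] sum_norm_sq_grad_le[of k]
    by (simp add: mean_grad_def g_def x_def)
  then have dev: "L2_set (\<lambda>i. norm (g i - mean_grad k)) {..<n} \<le> D"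
    unfolding L2_set_def using D_nonneg by (intro real_le_lsqrt) (auto intro: sum_nonneg)
  \<comment> \<open>Rows sum to 1, so mixing leaves the subtracted mean unchanged.\<close>
  have next_y: "dgd n W \<alpha> f (Suc k) i - dgd_mean n W \<alpha> f (Suc k)
      = (\<Sum>j<n. W $$ (i,j) *\<^sub>R y j) - \<alpha> *\<^sub>R (g i - mean_grad k)" if "i < n" for i
  proof -
    have "(\<Sum>j<n. W $$ (i,j) *\<^sub>R y j) = (\<Sum>j<n. W $$ (i,j) *\<^sub>R x j) - dgd_mean n W \<alpha> f k"
      using W_row[OF that] by (simp add: y_def scaleR_diff_right sum_subtractf scaleR_sum_left[symmetric])
    then show ?thesis unfolding dgd_mean_Suc by (simp add: x_def g_def algebra_simps)
  qed
  have "L2_set (\<lambda>i. norm (dgd n W \<alpha> f (Suc k) i - dgd_mean n W \<alpha> f (Suc k))) {..<n}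
      \<le> L2_set (\<lambda>i. norm (\<Sum>j<n. W $$ (i,j) *\<^sub>R y j) + \<alpha> * norm (g i - mean_grad k)) {..<n}"
  proof (rule L2_set_mono)
    fix i assume "i \<in> {..<n}"
    then have "i < n" by simp
    show "norm (dgd n W \<alpha> f (Suc k) i - dgd_mean n W \<alpha> f (Suc k))
        \<le> norm (\<Sum>j<n. W $$ (i,j) *\<^sub>R y j) + \<alpha> * norm (g i - mean_grad k)"
      unfolding next_y[OF \<open>i < n\<close>]
      using norm_triangle_ineq4[of "\<Sum>j<n. W $$ (i,j) *\<^sub>R y j" "\<alpha> *\<^sub>R (g i - mean_grad k)"] \<alpha>_pos
      by simp
  qed simp
  also have "\<dots> \<le> L2_set (\<lambda>i. norm (\<Sum>j<n. W $$ (i,j) *\<^sub>R y j)) {..<n}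
      + L2_set (\<lambda>i. \<alpha> * norm (g i - mean_grad k)) {..<n}"
    by (rule L2_set_triangle_ineq)
  also have "L2_set (\<lambda>i. \<alpha> * norm (g i - mean_grad k)) {..<n} = \<alpha> * L2_set (\<lambda>i. norm (g i - mean_grad k)) {..<n}"
    using \<alpha>_pos by (simp add: L2_set_right_distrib)
  also have "L2_set (\<lambda>i. norm (\<Sum>j<n. W $$ (i,j) *\<^sub>R y j)) {..<n} + \<dots> \<le> \<beta> * (\<alpha> * D / (1 - \<beta>)) + \<alpha> * D"
    using mixed dev \<alpha>_pos by (intro add_mono mult_left_mono) auto
  also have "\<dots> = \<alpha> * D / (1 - \<beta>)" using \<beta>_less by (simp add: field_simps)
  finally show ?case .
qed

text \<open>Lipschitz continuity turns the consensus bound into a bound on the gradient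
  error.\<close>

lemma mean_grad_deviation:
  "norm ((1 / real n) *\<^sub>R (\<Sum>i<n. grad (f i) (dgd_mean n W \<alpha> f k)) - mean_grad k) \<le> Lh * (\<alpha> * D / (1 - \<beta>))"
proof -
  define x where "x = dgd n W \<alpha> f k"
  define m where "m = dgd_mean n W \<alpha> f k"
  have "(1 / real n) *\<^sub>R (\<Sum>i<n. grad (f i) m) - mean_grad k
      = (1 / real n) *\<^sub>R (\<Sum>i<n. grad (f i) m - grad (f i) (x i))"
    by (simp add: mean_grad_def x_def sum_subtractf scaleR_diff_right)
  also have "norm \<dots> \<le> L2_set (\<lambda>i. norm (grad (f i) m - grad (f i) (x i))) {..<n}"
    by (rule norm_mean_le_L2_set)
  also have "\<dots> \<le> L2_set (\<lambda>i. Lh * norm (x i - m)) {..<n}"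
  proof (rule L2_set_mono)
    fix i assume "i \<in> {..<n}"
    then have i: "i < n" by simp
    have "norm (grad (f i) m - grad (f i) (x i)) \<le> L i * norm (m - x i)"
      using lipschitz_onD[OF f_lipschitz[OF i], of m "x i"] by (simp add: dist_norm)
    also have "\<dots> \<le> Lh * norm (x i - m)"
      using L_le[OF i] by (subst norm_minus_commute) (intro mult_right_mono, auto)
    finally show "norm (grad (f i) m - grad (f i) (x i)) \<le> Lh * norm (x i - m)" .
  qed simp
  also have "\<dots> = Lh * L2_set (\<lambda>i. norm (x i - m)) {..<n}"
    using Lh_pos by (simp add: L2_set_right_distrib)
  also have "\<dots> \<le> Lh * (\<alpha> * D / (1 - \<beta>))"
    using consensus_bound[of k] Lh_pos by (intro mult_left_mono) (auto simp: x_def m_def)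
  finally show ?thesis by (simp add: m_def)
qed

end

section \<open>Distance of the mean to the set of minimizers\<close>

lemma minimizers_iff: "z \<in> minimizers F \<longleftrightarrow> (\<forall>x. F z \<le> F x)" for F :: "'a \<Rightarrow> real"
  by (simp add: minimizers_def is_arg_min_linorder)

text \<open>The set is an intersection of closed sublevel sets. Closedness ensures that the
  projection onto it is attained.\<close>

lemma closed_minimizers:
  fixes F :: "'a::topological_space \<Rightarrow> real"
  assumes "continuous_on UNIV F"
  shows "closed (minimizers F)"
proof -
  have "minimizers F = (\<Inter>y. {x. F x \<le> F y})" by (auto simp: minimizers_iff)
  then show ?thesis using assms by (auto intro!: closed_Collect_le continuous_on_const)
qed

lemma lipschitz_on_sum:
  fixes g :: "'i \<Rightarrow> 'a::metric_space \<Rightarrow> 'b::real_normed_vector"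
  assumes "finite I" "\<And>i. i \<in> I \<Longrightarrow> (L i)-lipschitz_on S (g i)"
  shows "(\<Sum>i\<in>I. L i)-lipschitz_on S (\<lambda>x. \<Sum>i\<in>I. g i x)"
  using assms by (induction I rule: finite_induct) (auto intro: lipschitz_on_add lipschitz_on_constant)

lemma convex_on_sum_functions:
  assumes "finite I" "convex S" "\<And>i. i \<in> I \<Longrightarrow> convex_on S (f i)"
  shows "convex_on S (\<lambda>x. \<Sum>i\<in>I. f i x)"
  using assms by (induction I rule: finite_induct) (auto intro: convex_on_add simp: convex_on_const)

text \<open>A common form of both convexity cases: \<open>m\<close> is the modulus of
  \<open>F\<close>, \<open>c\<close> plays the role of \<open>c2\<close>, and the last assumption
  says that \<open>\<alpha>\<close> is at most the inverse of the averaged Lipschitz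
  constant.\<close>

locale dgd_convex = dgd_network n W \<alpha> Lh \<beta> f L
  for n W \<alpha> Lh \<beta> and f :: "nat \<Rightarrow> 'a::euclidean_space \<Rightarrow> real" and L +
  fixes F :: "'a \<Rightarrow> real" and xstar :: "nat \<Rightarrow> 'a" and m c :: real
  assumes f_convex: "\<And>i. i < n \<Longrightarrow> convex_on UNIV (f i)"
    and F_eq: "F = (\<lambda>x. \<Sum>i<n. f i x)"
    and minimizers_nonempty: "minimizers F \<noteq> {}"
    and xstar_eq: "\<And>k. xstar k = closest_point (minimizers F) (dgd_mean n W \<alpha> f k)"
    and monotone: "restricted_strongly_convex F m" and m_nonneg: "0 \<le> m"
    and c_le: "c \<le> m / real n"
    and step_le_mean: "\<alpha> * ((1 / real n) * (\<Sum>i<n. L i)) \<le> 1"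
begin

lemma GDERIV_F: "GDERIV F x :> (\<Sum>i<n. grad (f i) x)"
proof -
  have "(F has_derivative (\<lambda>h. \<Sum>i<n. inner h (grad (f i) x))) (at x)"
    unfolding F_eq using GDERIV_grad by (intro has_derivative_sum) (auto simp: gderiv_def)
  then show ?thesis by (simp add: gderiv_def inner_sum_right)
qed

lemma grad_F: "grad F x = (\<Sum>i<n. grad (f i) x)"
  by (rule grad_eqI[OF GDERIV_F])

lemma closed_minimizers_F: "closed (minimizers F)"
proof -
  have "continuous_on UNIV F"
    using GDERIV_F unfolding gderiv_def
    by (intro continuous_at_imp_continuous_on) (blast intro: has_derivative_continuous)
  then show ?thesis by (rule closed_minimizers)
qed

lemma xstar_minimizer: "xstar k \<in> minimizers F"
  unfolding xstar_eq by (rule closest_point_in_set[OF closed_minimizers_F minimizers_nonempty])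

lemma mean_gradient_step_contraction:
  "(norm (dgd_mean n W \<alpha> f k - xstar k
      - \<alpha> *\<^sub>R ((1 / real n) *\<^sub>R (\<Sum>i<n. grad (f i) (dgd_mean n W \<alpha> f k)))))\<^sup>2
    \<le> (1 - \<alpha> * c) * (norm (dgd_mean n W \<alpha> f k - xstar k))\<^sup>2"
proof -
  define x where "x = dgd_mean n W \<alpha> f k"
  have min: "F (xstar k) \<le> F y" for y using xstar_minimizer[of k] unfolding minimizers_iff by simp
  have grad: "GDERIV F y :> grad F y" for y using GDERIV_F grad_F by simp
  have L: "0 < (\<Sum>i<n. L i)" using L_pos n_pos by (intro sum_pos) auto
  have lip: "(\<Sum>i<n. L i)-lipschitz_on UNIV (grad F)"
    unfolding grad_F[abs_def] by (intro lipschitz_on_sum f_lipschitz) auto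
  have conv: "convex_on UNIV F"
    unfolding F_eq by (intro convex_on_sum_functions f_convex) auto
  have zero: "grad F (xstar k) = 0"
    using gradient_bound_gap[OF grad lip L min, of "xstar k"] by simp
  have "m * (norm (x - xstar k))\<^sup>2 \<le> inner (grad F x - grad F (xstar k)) (x - xstar k)"
    unfolding xstar_eq x_def
    by (rule monotone[unfolded restricted_strongly_convex_def Let_def, rule_format])
  then have 1: "m / real n * (norm (x - xstar k))\<^sup>2 \<le> inner ((1 / real n) *\<^sub>R grad F x) (x - xstar k)"
    using zero n_pos by (simp add: divide_right_mono)
  have "(norm (grad F x))\<^sup>2 \<le> (\<Sum>i<n. L i) * inner (grad F x) (x - xstar k)"
    by (rule cocoercive_at_minimum[OF grad lip L conv min])
  \<comment> \<open>Of the two factors \<open>1 / real n\<close> on the right, one averages the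
    Lipschitz constants and the other scales the gradient.\<close>
  from mult_left_mono[OF this, of "(1 / real n)\<^sup>2"]
  have 2: "(norm ((1 / real n) *\<^sub>R grad F x))\<^sup>2
      \<le> ((1 / real n) * (\<Sum>i<n. L i)) * inner ((1 / real n) *\<^sub>R grad F x) (x - xstar k)"
    by (simp add: power_divide power2_eq_square mult_ac)
  have "(norm (x - xstar k - \<alpha> *\<^sub>R ((1 / real n) *\<^sub>R grad F x)))\<^sup>2 \<le> (1 - \<alpha> * c) * (norm (x - xstar k))\<^sup>2"
    by (rule gradient_step_contraction[OF 1 2 \<alpha>_pos _ step_le_mean c_le]) (simp add: m_nonneg)
  then show ?thesis by (simp add: x_def grad_F)
qed

text \<open>The mean makes an exact gradient step for the averaged objective plus
  \<open>\<alpha>\<close> times the gradient error. The first part contracts, and the weighted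
  inequality separates the second.\<close>

lemma mean_error_recursion:
  assumes "0 < \<delta>"
  shows "(norm (dgd_mean n W \<alpha> f (Suc k) - xstar (Suc k)))\<^sup>2
    \<le> (1 + \<alpha> * \<delta>) * (1 - \<alpha> * c) * (norm (dgd_mean n W \<alpha> f k - xstar k))\<^sup>2
      + \<alpha> ^ 3 * (\<alpha> + inverse \<delta>) * (Lh\<^sup>2 * D\<^sup>2 / (1 - \<beta>)\<^sup>2)"
proof -
  define x where "x = dgd_mean n W \<alpha> f k"
  define p where "p = (1 / real n) *\<^sub>R (\<Sum>i<n. grad (f i) x)"
  define e where "e = p - mean_grad k"
  have e: "(norm e)\<^sup>2 \<le> (Lh * (\<alpha> * D / (1 - \<beta>)))\<^sup>2"
    using mean_grad_deviation[of k] by (intro power_mono) (auto simp: e_def p_def x_def)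
  \<comment> \<open>The projection moves with the mean. The new one is closest to the new mean, so
    the old one may be used in its place.\<close>
  have "norm (dgd_mean n W \<alpha> f (Suc k) - xstar (Suc k)) \<le> norm (dgd_mean n W \<alpha> f (Suc k) - xstar k)"
    using closest_point_le[OF closed_minimizers_F xstar_minimizer, of "dgd_mean n W \<alpha> f (Suc k)" k]
    by (simp add: xstar_eq[of "Suc k"] dist_norm)
  then have "(norm (dgd_mean n W \<alpha> f (Suc k) - xstar (Suc k)))\<^sup>2
      \<le> (norm (dgd_mean n W \<alpha> f (Suc k) - xstar k))\<^sup>2"
    by (rule power_mono) simp
  also have "dgd_mean n W \<alpha> f (Suc k) - xstar k = (x - xstar k - \<alpha> *\<^sub>R p) + \<alpha> *\<^sub>R e"
    unfolding dgd_mean_Suc e_def x_def by (simp add: algebra_simps)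
  also have "(norm \<dots>)\<^sup>2 \<le> (1 + \<alpha> * \<delta>) * (norm (x - xstar k - \<alpha> *\<^sub>R p))\<^sup>2
      + (1 + inverse (\<alpha> * \<delta>)) * (norm (\<alpha> *\<^sub>R e))\<^sup>2"
    using \<alpha>_pos assms by (intro norm_add_sq_le_weighted) simp
  also have "\<dots> \<le> (1 + \<alpha> * \<delta>) * ((1 - \<alpha> * c) * (norm (x - xstar k))\<^sup>2)
      + (1 + inverse (\<alpha> * \<delta>)) * (\<alpha>\<^sup>2 * (Lh * (\<alpha> * D / (1 - \<beta>)))\<^sup>2)"
    using \<alpha>_pos assms e mean_gradient_step_contraction[of k]
    by (intro add_mono mult_left_mono) (auto simp: p_def x_def power_mult_distrib)
  also have "(1 + inverse (\<alpha> * \<delta>)) * (\<alpha>\<^sup>2 * (Lh * (\<alpha> * D / (1 - \<beta>)))\<^sup>2)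
      = ((1 + inverse (\<alpha> * \<delta>)) * \<alpha>\<^sup>2 * \<alpha>\<^sup>2) * (Lh\<^sup>2 * D\<^sup>2 / (1 - \<beta>)\<^sup>2)"
    by (simp add: power_mult_distrib power_divide)
  \<comment> \<open>One factor \<open>\<alpha>\<^sup>2\<close> comes from the step and the other
    from the consensus bound.\<close>
  also have "(1 + inverse (\<alpha> * \<delta>)) * \<alpha>\<^sup>2 * \<alpha>\<^sup>2 = \<alpha> ^ 3 * (\<alpha> + inverse \<delta>)"
    using \<alpha>_pos assms by (simp add: field_simps power2_eq_square power3_eq_cube)
  finally show ?thesis by (simp add: x_def mult.assoc)
qed

text \<open>Triangle inequality through the mean: consensus error plus distance of the mean to its
  projection. The mean starts at 0, so the initial error is \<open>norm (xstar 0)\<close>.\<close>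

lemma dgd_error_bound:
  assumes "0 < \<delta>" and c3_sq: "c3\<^sup>2 = (1 + \<alpha> * \<delta>) * (1 - \<alpha> * c)" and "0 \<le> c3" "c3 < 1"
    and "0 \<le> c4" and c4_sq: "c4\<^sup>2 = \<alpha> ^ 3 * (\<alpha> + inverse \<delta>) * (Lh\<^sup>2 * D\<^sup>2 / (1 - \<beta>)\<^sup>2)"
    and i: "i < n"
  shows "norm (dgd n W \<alpha> f k i - xstar k)
    \<le> c3 ^ k * norm (xstar 0) + c4 / sqrt (1 - c3\<^sup>2) + \<alpha> * D / (1 - \<beta>)"
proof -
  define x where "x = dgd_mean n W \<alpha> f k"
  have "norm (x - xstar k) \<le> c3 ^ k * norm (dgd_mean n W \<alpha> f 0 - xstar 0) + c4 / sqrt (1 - c3\<^sup>2)"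
    unfolding x_def
    using affine_square_recursion_bound[of "\<lambda>k. norm (dgd_mean n W \<alpha> f k - xstar k)" c3 c4 k]
      mean_error_recursion[OF \<open>0 < \<delta>\<close>] assms by simp
  moreover have "dgd_mean n W \<alpha> f 0 = 0" by (simp add: dgd_mean_def)
  moreover have "norm (dgd n W \<alpha> f k i - x) \<le> \<alpha> * D / (1 - \<beta>)"
    using member_le_L2_set[of "{..<n}" i "\<lambda>i. norm (dgd n W \<alpha> f k i - x)"] i consensus_bound[of k]
    by (simp add: x_def)
  moreover have "norm (dgd n W \<alpha> f k i - xstar k) \<le> norm (dgd n W \<alpha> f k i - x) + norm (x - xstar k)"
    using norm_triangle_ineq[of "dgd n W \<alpha> f k i - x" "x - xstar k"] by simp
  ultimately show ?thesis by simp
qed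

end

lemma strongly_convex_imp_restricted:
  "strongly_convex F \<mu> \<Longrightarrow> restricted_strongly_convex F \<mu>"
  by (simp add: strongly_convex_def restricted_strongly_convex_def Let_def)

section \<open>Reduction of both convexity cases to the common setting\<close>

theorem corollary1:
  fixes n i k :: nat
    and f :: "nat \<Rightarrow> real ^ 'p \<Rightarrow> real"
    and F :: "real ^ 'p \<Rightarrow> real"
    and L :: "nat \<Rightarrow> real"
    and W :: "real mat"
    and E :: "(nat \<times> nat) set"
    and xstar :: "nat \<Rightarrow> real ^ 'p"
    and \<alpha> \<beta> \<delta> \<mu> \<nu> \<theta> Lh Lbar c1 c2 c3 c4 D :: real
  assumes f_convex: "\<And>i. i < n \<Longrightarrow> convex_on UNIV (f i)"
    and f_bounded: "\<And>i. i < n \<Longrightarrow> bdd_below (range (f i))"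
    and f_diff: "\<And>i. i < n \<Longrightarrow> f i differentiable_on UNIV"
    and L_pos: "\<And>i. i < n \<Longrightarrow> L i > 0"
    and f_lipschitz: "\<And>i. i < n \<Longrightarrow> (L i)-lipschitz_on UNIV (grad (f i))"
    and F_eq: "F = (\<lambda>x. \<Sum>i<n. f i x)"
    and minimizers_nonempty: "minimizers F \<noteq> {}"
    and network: "connected_network n E"
    and mixing: "mixing_matrix n E W"
    and \<beta>_eq: "\<beta> = max \<bar>eigval W 2\<bar> \<bar>eigval W n\<bar>"
    and \<beta>_less: "\<beta> < 1"
    and Lh_eq: "Lh = Max (L ` {..<n})"
    and Lbar_eq: "Lbar = (1 / real n) * (\<Sum>i<n. L i)"
    and convexity_cases:
      "(strongly_convex F \<mu> \<and> \<mu> > 0 \<and>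
          c1 = 1 / (\<mu> / real n + Lbar) \<and>
          c2 = (\<mu> / real n) * Lbar / (\<mu> / real n + Lbar)) \<or>
       (restricted_strongly_convex F \<nu> \<and> \<nu> > 0 \<and> \<theta> \<in> {0..1} \<and>
          c1 = \<theta> / Lbar \<and>
          c2 = (1 - \<theta>) * (\<nu> / real n))"
    and \<alpha>_pos: "\<alpha> > 0"
    and \<alpha>_less: "\<alpha> < min ((1 + eigval W n) / Lh) c1"
    and \<delta>_pos: "\<delta> > 0"
    and D_eq: "D = sqrt (2 * Lh * (\<Sum>i<n. f i 0 - opt_value (f i)))"
    and c3_sq: "c3\<^sup>2 = 1 - \<alpha> * c2 + \<alpha> * \<delta> - \<alpha>\<^sup>2 * \<delta> * c2"
    and c3_range: "0 \<le> c3" "c3 < 1" \<comment> \<open>needed for \<open>1 / sqrt (1 - c3\<^sup>2)\<close> to make sense\<close>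
    and c4_nonneg: "0 \<le> c4"
    and c4_sq: "c4\<^sup>2 = \<alpha> ^ 3 * (\<alpha> + inverse \<delta>) * (Lh\<^sup>2 * D\<^sup>2 / (1 - \<beta>)\<^sup>2)"
    and xstar_eq: "\<And>k. xstar k = closest_point (minimizers F) (dgd_mean n W \<alpha> f k)"
    and i_less: "i < n"
  shows "norm (dgd n W \<alpha> f k i - xstar k)
           \<le> c3 ^ k * norm (xstar 0) + c4 / sqrt (1 - c3\<^sup>2) + \<alpha> * D / (1 - \<beta>)"
proof -
  have n_pos: "0 < n" using i_less by simp
  have L_le: "L j \<le> Lh" if "j < n" for j unfolding Lh_eq using that by (intro Max_ge) auto
  have Lh_pos: "0 < Lh" using L_pos[OF n_pos] L_le[OF n_pos] by simp
  have "0 < (\<Sum>i<n. L i)" using L_pos n_pos by (intro sum_pos) auto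
  then have Lbar_pos: "0 < Lbar" unfolding Lbar_eq using n_pos by simp
  have "\<alpha> < (1 + eigval W n) / Lh" using \<alpha>_less by simp
  then have step: "\<alpha> * Lh \<le> 1 + eigval W n" using Lh_pos by (simp add: field_simps)
  have "\<alpha> < c1" using \<alpha>_less by simp
  \<comment> \<open>Take \<open>m\<close> to be \<open>\<mu>\<close> or \<open>\<nu>\<close>. In the
    first case \<open>c2\<close> is \<open>\<mu> / real n\<close> times a fraction below 1; in the
    second that fraction is \<open>1 - \<theta>\<close>.\<close>
  obtain m where m: "restricted_strongly_convex F m" "0 \<le> m" "c2 \<le> m / real n" "c1 \<le> 1 / Lbar"
  proof (use convexity_cases in \<open>elim disjE conjE\<close>)
    assume sc: "strongly_convex F \<mu>" and \<mu>: "\<mu> > 0"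
      and c: "c1 = 1 / (\<mu> / real n + Lbar)" "c2 = \<mu> / real n * Lbar / (\<mu> / real n + Lbar)"
    have m: "0 < \<mu> / real n" using \<mu> n_pos by simp
    then have "\<mu> / real n * Lbar \<le> \<mu> / real n * (\<mu> / real n + Lbar)"
      by (intro mult_left_mono) auto
    then have "c2 \<le> \<mu> / real n" unfolding c using m Lbar_pos by (subst pos_divide_le_eq) auto
    moreover have "c1 \<le> 1 / Lbar" unfolding c using m Lbar_pos by (intro divide_left_mono) auto
    ultimately show thesis using that[of \<mu>] strongly_convex_imp_restricted[OF sc] \<mu> by simp
  next
    assume rsc: "restricted_strongly_convex F \<nu>" and \<nu>: "\<nu> > 0" and \<theta>: "\<theta> \<in> {0..1}"
      and c: "c1 = \<theta> / Lbar" "c2 = (1 - \<theta>) * (\<nu> / real n)"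
    have "c2 \<le> 1 * (\<nu> / real n)" unfolding c using \<theta> \<nu> by (intro mult_right_mono) auto
    moreover have "c1 \<le> 1 / Lbar" unfolding c using \<theta> Lbar_pos by (intro divide_right_mono) auto
    ultimately show thesis using that[of \<nu>] rsc \<nu> by simp
  qed
  have "\<alpha> \<le> 1 / Lbar" using \<open>\<alpha> < c1\<close> m(4) by simp
  then have "\<alpha> * Lbar \<le> 1" using Lbar_pos by (simp add: field_simps)
  then have step_mean: "\<alpha> * (1 / real n * (\<Sum>i<n. L i)) \<le> 1" unfolding Lbar_eq .
  have W: "W \<in> carrier_mat n n" "transpose_mat W = W" "doubly_stochastic n W"
    using mixing by (simp_all add: mixing_matrix_def)
  interpret dgd_network n W \<alpha> Lh \<beta> f L
    by unfold_locales (fact W \<beta>_eq \<beta>_less n_pos f_diff f_bounded f_lipschitz L_pos L_le \<alpha>_pos step)+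
  interpret dgd_convex n W \<alpha> Lh \<beta> f L F xstar m c2
    by unfold_locales (fact f_convex F_eq minimizers_nonempty xstar_eq m step_mean)+
  have D: "D = dgd_network.D n Lh f" unfolding D_eq D_def ..
  show ?thesis
    unfolding D
  proof (rule dgd_error_bound[OF \<delta>_pos _ c3_range c4_nonneg _ i_less])
    \<comment> \<open>The given polynomial factors into the weight of Young's inequality and the
      contraction factor of the exact step.\<close>
    show "c3\<^sup>2 = (1 + \<alpha> * \<delta>) * (1 - \<alpha> * c2)"
      unfolding c3_sq by (simp add: algebra_simps power2_eq_square)
  qed (use c4_sq D in simp)
qed

end
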